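(* For $n\ge 1$, \[\sum_{\sigma\in\mathcal W_3(n)}x^{\operatorname{des}(\sigma)+1}y^{\operatorname{peak}(\sigma)+1}=\sum_{g=1}^{n+1}E^{(g)}_{\ge 0}(n),\] where the polynomials $E^{(g)}_{\ge\ell}(n)$ satisfy: $E^{(0)}_{\ge\ell}(n)=0$; $E^{(g)}_{\ge\ell}(1)=L_{\ell+1}(x,y)$ if $g=2$ and $E^{(g)}_{\ge\ell}(1)=0$ if $g\ne 2$; and for all $n,g\ge 1$ and $\ell\ge 0$, \[E^{(g)}_{\ge\ell}(n+1)=\sum_{j=1}^{\ell}\left(\sum_{a=2}^{n}\ \sum_{b=\max\{2,g-a\}}^{g-1}\ \sum_{i=a-1}^{n-b+1}E^{(a)}_{\ge j-1}(i)\,E^{(b)}_{\ge \ell-j+1}(n-i)+E^{(g-1)}_{\ge j-1}(n)\,L_{\ell-j+1}(x,y)\right)+E^{(g-1)}_{\ge\ell+1}(n).\]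
   Context: $S_n$ is the set of permutations of $\{1,\dots,n\}$ in one-line notation. For $\pi=\pi_1\cdots\pi_N$, $\operatorname{des}(\pi)$ is the number of $i\in[N-1]$ with $\pi_i>\pi_{i+1}$, and $\operatorname{peak}(\pi)$ is the number of $i\in\{2,\dots,N-1\}$ with $\pi_{i-1}<\pi_i>\pi_{i+1}$. The stack-sorting map $s$: given an input permutation, repeatedly: if the stack is empty or the next input entry is smaller than the top of the stack, push the next input entry; otherwise pop the top of the stack to the end of the output. $s(\pi)$ is the final output; $s^{-1}(A)$ is the set of preimages of elements of $A$. A permutation $\pi$ is $t$-stack-sortable if $s^t(\pi)$ is increasing; $\mathcal W_t(n)$ is the set of $t$-stack-sortable permutations in $S_n$. For $\pi\in S_N$, the tail length $\operatorname{tl}(\pi)$ is the smallest nonnegative integer $\ell$ with $\pi_{N-\ell}\ne N-\ell$ (with $\operatorname{tl}(12\cdots N)=N$). For $a\in\{0,\dots,N\}$, $(a,a+1)$ is a legal space for $\pi$ if there are no indices $i_1<i_2<i_3$ with $\pi_{i_3}\le a<\pi_{i_1}<\pi_{i_2}$; $\operatorname{leg}(\pi)$ is the number of legal spaces. For $n\ge1,\ell\ge0,g\ge0$, let $\mathcal D^{(g)}_{\ge\ell}(n)=\{\pi\in\mathcal W_2(n+\ell):\operatorname{tl}(\pi)\ge\ell,\ \operatorname{leg}(\pi)=\ell+g\}$ and $E^{(g)}_{\ge\ell}(n)=\sum_{\sigma\in s^{-1}(\mathcal D^{(g)}_{\ge\ell}(n))}x^{\operatorname{des}(\sigma)+1}y^{\operatorname{peak}(\sigma)+1}$.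 For $r\ge1$, $L(r,i,j)$ is the number of binary plane trees with $r$ vertices, $i-1$ right edges and $j$ leaves (explicitly $L(r,i,j)=\frac{1}{r+1-j}\binom{r-1}{r-j}\binom{r+1-j}{j}\binom{r+1-2j}{i-j}$), and $L_r(x,y)=\sum_{i=1}^r\sum_{j=1}^rL(r,i,j)x^iy^j$. *)

theory Defs
  imports
    "HOL-Combinatorics.Multiset_Permutations"
    "HOL-Computational_Algebra.Polynomial"
    "HOL-Library.Tree"
begin

(* A word pi_1 ... pi_N is a list p with pi_i = p ! (i - 1). *)

abbreviation perms :: "nat \<Rightarrow> nat list set" where
  "perms n \<equiv> permutations_of_set {1..n}"

definition des :: "nat list \<Rightarrow> nat" where
  "des p = card {i. i + 1 < length p \<and> p ! i > p ! (i + 1)}"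

definition peak :: "nat list \<Rightarrow> nat" where
  "peak p = card {i. i + 2 < length p \<and> p ! i < p ! (i + 1) \<and> p ! (i + 1) > p ! (i + 2)}"

(* Arguments: remaining input, stack (top first), output so far. *)
fun stack_run :: "nat list \<Rightarrow> nat list \<Rightarrow> nat list \<Rightarrow> nat list" where
  "stack_run [] [] out = out"
| "stack_run [] (t # st) out = stack_run [] st (out @ [t])"
| "stack_run (x # xs) [] out = stack_run xs [x] out"
| "stack_run (x # xs) (t # st) out =
    (if x < t then stack_run xs (x # t # st) out
     else stack_run (x # xs) st (out @ [t]))"

definition stack_sort :: "nat list \<Rightarrow> nat list" where
  "stack_sort p = stack_run p [] []"

definition stack_sortable :: "nat \<Rightarrow> nat \<Rightarrow> nat list set" where
  "stack_sortable t n = {p \<in> perms n. sorted ((stack_sort ^^ t) p)}"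

definition tail_length :: "nat list \<Rightarrow> nat" where
  "tail_length p =
    (let N = length p in
     if p = [1..<N + 1] then N
     else (LEAST l. l < N \<and> p ! (N - l - 1) \<noteq> N - l))"

definition legal_space :: "nat list \<Rightarrow> nat \<Rightarrow> bool" where
  "legal_space p a \<longleftrightarrow>
    \<not> (\<exists>i1 i2 i3. i1 < i2 \<and> i2 < i3 \<and> i3 < length p \<and>
          p ! i3 \<le> a \<and> a < p ! i1 \<and> p ! i1 < p ! i2)"

definition leg :: "nat list \<Rightarrow> nat" where
  "leg p = card {a \<in> {0..length p}. legal_space p a}"

definition D_set :: "nat \<Rightarrow> nat \<Rightarrow> nat \<Rightarrow> nat list set" where
  "D_set g l n = {p \<in> stack_sortable 2 (n + l). tail_length p \<ge> l \<and> leg p = l + g}"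

(* The ring Z[x,y] is represented as Z[x][y]. *)
type_synonym poly_xy = "int poly poly"

definition x_var :: poly_xy where "x_var = [:[:0, 1:]:]"
definition y_var :: poly_xy where "y_var = [:0, 1:]"

definition des_peak_poly :: "nat list set \<Rightarrow> poly_xy" where
  "des_peak_poly A = (\<Sum>p\<in>A. x_var ^ (des p + 1) * y_var ^ (peak p + 1))"

(* The preimage is taken among all words. Since stack_sort only rearranges the entries
   of its argument, every word in it is a permutation of {1..n + l}. *)
definition E_poly :: "nat \<Rightarrow> nat \<Rightarrow> nat \<Rightarrow> poly_xy" where
  "E_poly g l n = des_peak_poly (stack_sort -` D_set g l n)"

(* A binary plane tree is a value of type unit tree: its vertices are the Node constructors,
   so its number of vertices is size, and the constructor Leaf denotes an absent subtree.
   A leaf in the graph-theoretic sense is a Node without children. *)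
fun right_edges :: "'a tree \<Rightarrow> nat" where
  "right_edges Leaf = 0"
| "right_edges (Node l a r) = (if r = Leaf then 0 else 1) + right_edges l + right_edges r"

fun num_leaves :: "'a tree \<Rightarrow> nat" where
  "num_leaves Leaf = 0"
| "num_leaves (Node l a r) =
    (if l = Leaf \<and> r = Leaf then 1 else num_leaves l + num_leaves r)"

definition L_num :: "nat \<Rightarrow> nat \<Rightarrow> nat \<Rightarrow> nat" where
  "L_num r i j = card {t :: unit tree. size t = r \<and> right_edges t = i - 1 \<and> num_leaves t = j}"

definition L_poly :: "nat \<Rightarrow> poly_xy" where
  "L_poly r = (\<Sum>i = 1..r. \<Sum>j = 1..r. of_nat (L_num r i j) * x_var ^ i * y_var ^ j)"

end

theory Submission
  imports Defs "HOL-Library.Sublist"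
begin

text \<open>
  Let \<open>F(w)\<close> be the generating polynomial of the fibre of the stack-sorting map \<open>s\<close> over a word \<open>w\<close>.
  Since \<open>s (A m B) = s A \<cdot> s B \<cdot> m\<close> for the maximum \<open>m\<close>, the polynomial \<open>F(w m)\<close> vanishes unless
  \<open>m\<close> is the maximum, and then it is \<open>(1 + x) F(w)\<close> plus the sum of \<open>F(u) F(v)\<close> over all splittings
  \<open>w = u v\<close> into nonempty factors. Counting binary plane trees by their root gives the same recursion,
  so \<open>F\<close> of an increasing word is \<open>L\<close>. Iterating it along an increasing tail \<open>t\<close> yields a sum over
  hooks: for \<open>m\<close> larger than all letters of \<open>l\<close> and of the nonempty word \<open>r\<close>, the polynomial
  \<open>F(l m r t)\<close> is the sum of \<open>F(l m t'') F(r t')\<close> over the factorizations \<open>t = t' z t''\<close> at a letter \<open>z\<close>.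

  The elements of \<open>D\<close> are the words \<open>q\<close> followed by an increasing tail, with \<open>q\<close> 2-stack-sortable with
  \<open>g\<close> legal spaces. If \<open>q = l (n + 1) r\<close> with \<open>l\<close> and \<open>r\<close> nonempty, then \<open>s q = s l \<cdot> s r \<cdot> (n + 1)\<close> avoids
  231 iff \<open>l\<close> and \<open>r\<close> are 2-stack-sortable, all letters of \<open>l\<close> except its maximum are below \<open>r\<close>, and
  the maximum of \<open>l\<close> lies in a legal space of \<open>r\<close>. Choosing the \<open>c\<close>-th legal space of \<open>r\<close> from the top gives
  \<open>leg q = leg l + c\<close>, so each pair of patterns for \<open>l\<close> and \<open>r\<close> contributes once for every \<open>g\<close> with
  \<open>leg l < g \<le> leg l + leg r\<close>. The remaining cases, \<open>l\<close> or \<open>r\<close> empty, give the terms with \<open>g - 1\<close>.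
\<close>

section \<open>Fibres of the stack-sorting map\<close>

lemma mset_stack_run: "mset (stack_run xs st out) = mset xs + mset st + mset out"
  by (induction xs st out rule: stack_run.induct) auto

lemma mset_stack_sort [simp]: "mset (stack_sort w) = mset w"
  by (simp add: stack_sort_def mset_stack_run)

lemma set_stack_sort [simp]: "set (stack_sort w) = set w"
  by (rule mset_eq_setD) simp

lemma length_stack_sort [simp]: "length (stack_sort w) = length w"
  by (rule mset_eq_length) simp

lemma distinct_stack_sort [simp]: "distinct (stack_sort w) = distinct w"
  by (rule mset_eq_imp_distinct_iff) simp

lemma stack_sort_Nil [simp]: "stack_sort [] = []"
  by (simp add: stack_sort_def)

lemma stack_sort_eq_Nil_iff [simp]: "stack_sort w = [] \<longleftrightarrow> w = []"
  by (metis length_stack_sort length_0_conv)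

text \<open>The output is never inspected, so letters already emitted can be split off.\<close>

lemma stack_run_out: "stack_run xs st (out @ out') = out @ stack_run xs st out'"
  by (induction xs st out' arbitrary: out rule: stack_run.induct) (auto simp flip: append_assoc)

text \<open>Before the input ends, a letter is popped only by an input letter that is not smaller.
  No letter of \<open>xs\<close> does this to \<open>m\<close>, so \<open>m\<close> stays at the
  bottom and leaves last.\<close>

lemma stack_run_bottom:
  "\<forall>x\<in>set xs. x < m \<Longrightarrow> stack_run xs (st @ [m]) out = stack_run xs st out @ [m]"
  by (induction xs st out rule: stack_run.induct) auto

text \<open>All stacked letters are below \<open>m\<close>, so the arrival of \<open>m\<close>
  empties the stack exactly as the end of the input would.\<close>

lemma stack_run_flush:
  "\<forall>x\<in>set xs \<union> set st. x < m \<Longrightarrow>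
    stack_run (xs @ m # ys) st out = stack_run ys [m] (stack_run xs st out)"
  by (induction xs st out rule: stack_run.induct) auto

text \<open>First \<open>m\<close> flushes what is left of \<open>u\<close>, then it lies under
  \<open>v\<close> until the end. Most later arguments use this recursion in place of the
  operational definition.\<close>

lemma stack_sort_max:
  assumes "\<forall>x\<in>set u \<union> set v. x < m"
  shows "stack_sort (u @ m # v) = stack_sort u @ stack_sort v @ [m]"
proof -
  have "stack_sort (u @ m # v) = stack_run v [m] (stack_sort u)"
    using assms unfolding stack_sort_def by (subst stack_run_flush) auto
  also have "\<dots> = stack_sort u @ stack_run v [m] []"
    using stack_run_out[of v "[m]" "stack_sort u" "[]"] by simp
  also have "stack_run v [m] [] = stack_sort v @ [m]"
    using stack_run_bottom[of v m "[]" "[]"] assms by (simp add: stack_sort_def)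
  finally show ?thesis .
qed

lemma distinct_split_max:
  fixes w :: "'a::linorder list"
  assumes "distinct w" "w \<noteq> []"
  obtains u m v where "w = u @ m # v" "\<forall>x\<in>set u \<union> set v. x < m"
proof -
  have "Max (set w) \<in> set w" using assms by simp
  then obtain u v where uv: "w = u @ Max (set w) # v" by (meson split_list)
  have "x < Max (set w)" if "x \<in> set u \<union> set v" for x
  proof -
    have "x \<in> set w" using that by (subst uv) auto
    then have "x \<le> Max (set w)" by simp
    moreover have "x \<noteq> Max (set w)" using that assms(1) by (subst (asm) uv) auto
    ultimately show ?thesis by simp
  qed
  then show ?thesis using that uv by blast
qed

text \<open>Induction along the recursion of \<open>stack_sort_max\<close>.\<close>

lemma distinct_max_induct [consumes 1, case_names Nil Max]:
  fixes w :: "'a::linorder list"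
  assumes "distinct w" "P []"
    and step: "\<And>u m v. distinct (u @ m # v) \<Longrightarrow> \<forall>x\<in>set u \<union> set v. x < m \<Longrightarrow>
      P u \<Longrightarrow> P v \<Longrightarrow> P (u @ m # v)"
  shows "P w"
  using assms(1)
proof (induction "length w" arbitrary: w rule: less_induct)
  case less
  show ?case
  proof (cases "w = []")
    case False
    obtain u m v where w: "w = u @ m # v" "\<forall>x\<in>set u \<union> set v. x < m"
      using distinct_split_max[OF less.prems False] .
    show ?thesis using less w by (auto intro!: step)
  qed (use assms(2) in simp)
qed

text \<open>Only comparisons steer the sorting, so order-preserving relabelling commutes with
  it.\<close>

lemma stack_sort_map:
  assumes "distinct w" "strict_mono_on (set w) h"
  shows "stack_sort (map h w) = map h (stack_sort w)"
  using assms
proof (induction rule: distinct_max_induct)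
  case (Max u m v)
  have mono: "strict_mono_on (set u) h" "strict_mono_on (set v) h"
    using Max.prems by (auto intro: monotone_on_subset)
  have "\<forall>x\<in>set u \<union> set v. h x < h m"
    using Max by (auto intro: strict_mono_onD)
  then have "stack_sort (map h u @ h m # map h v) =
      stack_sort (map h u) @ stack_sort (map h v) @ [h m]"
    by (intro stack_sort_max) auto
  then show ?case using Max.IH Max.hyps(2) mono by (simp add: stack_sort_max)
qed simp

section \<open>Descents and peaks of a word split at its maximum\<close>

lemma des_Cons: "des (x # xs) = (if xs \<noteq> [] \<and> x > hd xs then 1 else 0) + des xs"
proof -
  let ?S = "{i. i + 1 < length xs \<and> xs ! i > xs ! (i + 1)}"
  have "finite ?S" by (rule finite_subset[of _ "{..<length xs}"]) auto
  have "{i. i + 1 < length (x # xs) \<and> (x # xs) ! i > (x # xs) ! (i + 1)} =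
      (if xs \<noteq> [] \<and> x > hd xs then {0} else {}) \<union> Suc ` ?S" (is "?A = ?B")
  proof (rule set_eqI)
    fix i show "i \<in> ?A \<longleftrightarrow> i \<in> ?B"
      by (cases i) (auto simp: hd_conv_nth)
  qed
  then show ?thesis using \<open>finite ?S\<close>
    by (auto simp: des_def card_image card_insert_if)
qed

lemma des_Nil [simp]: "des [] = 0" by (simp add: des_def)
lemma peak_Nil [simp]: "peak [] = 0" by (simp add: peak_def)
lemma peak_single [simp]: "peak [x] = 0" by (simp add: peak_def)
lemma peak_double [simp]: "peak [x, y] = 0" by (simp add: peak_def)

lemma peak_Cons: "peak (x # y # z # zs) = (if x < y \<and> z < y then 1 else 0) + peak (y # z # zs)"
proof -
  let ?S = "{i. i + 2 < length (y # z # zs) \<and> (y # z # zs) ! i < (y # z # zs) ! (i + 1) \<and>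
    (y # z # zs) ! (i + 1) > (y # z # zs) ! (i + 2)}"
  have "finite ?S" by (rule finite_subset[of _ "{..<length (y # z # zs)}"]) auto
  have "{i. i + 2 < length (x # y # z # zs) \<and> (x # y # z # zs) ! i < (x # y # z # zs) ! (i + 1) \<and>
    (x # y # z # zs) ! (i + 1) > (x # y # z # zs) ! (i + 2)} =
      (if x < y \<and> z < y then {0} else {}) \<union> Suc ` ?S" (is "?A = ?B")
  proof (rule set_eqI)
    fix i show "i \<in> ?A \<longleftrightarrow> i \<in> ?B"
      by (cases i) auto
  qed
  then show ?thesis using \<open>finite ?S\<close>
    by (auto simp: peak_def card_image card_insert_if)
qed

text \<open>The step up to \<open>m\<close> is an ascent; the step down from \<open>m\<close> is a
  descent and exists unless \<open>v\<close> is empty.\<close>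

lemma des_max:
  "\<forall>x\<in>set u \<union> set v. x < m \<Longrightarrow>
    des (u @ m # v) = des u + des v + (if v = [] then 0 else 1)"
proof (induction u)
  case Nil
  then show ?case by (auto simp: des_Cons)
next
  case (Cons x u)
  then show ?case by (cases u) (auto simp: des_Cons)
qed

text \<open>With a neighbour on each side \<open>m\<close> is a peak, and its neighbours cannot be
  peaks because \<open>m\<close> exceeds them.\<close>

lemma peak_max:
  "\<forall>x\<in>set u \<union> set v. x < m \<Longrightarrow>
    peak (u @ m # v) = peak u + peak v + (if u = [] \<or> v = [] then 0 else 1)"
proof (induction u)
  case Nil
  show ?case
  proof (cases v)
    case (Cons a v')
    then show ?thesis using Nil by (cases v') (auto simp: peak_Cons)
  qed simp
next
  case (Cons x u)
  show ?case
  proof (cases u)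
    case Nil
    then show ?thesis using Cons by (cases v) (auto simp: peak_Cons)
  next
    case u: (Cons y u')
    then show ?thesis using Cons
      by (cases u') (auto simp: peak_Cons)
  qed
qed

text \<open>This is the polynomial \<open>F(w)\<close> of the overview.\<close>

definition preimage_poly :: "nat list \<Rightarrow> poly_xy" where
  "preimage_poly w = des_peak_poly (stack_sort -` {w})"

lemma preimage_poly_altdef:
  "preimage_poly w = (\<Sum>p | stack_sort p = w. x_var ^ (des p + 1) * y_var ^ (peak p + 1))"
  unfolding preimage_poly_def des_peak_poly_def by (rule sum.cong) auto

lemma finite_stack_sort_fibre: "finite {p. stack_sort p = w}"
proof (rule finite_subset)
  show "{p. stack_sort p = w} \<subseteq> {p. mset p = mset w}" using mset_stack_sort by auto
qed (rule mset_eq_finite)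

text \<open>By \<open>stack_sort_max\<close> every nonempty sorted image ends in its maximum, so
  this fibre is empty.\<close>

lemma preimage_poly_not_max:
  assumes "distinct (w @ [m])" "x \<in> set w" "m < x"
  shows "preimage_poly (w @ [m]) = 0"
proof -
  have False if "stack_sort p = w @ [m]" for p
  proof -
    have "distinct p" by (metis that assms(1) distinct_stack_sort)
    moreover have "p \<noteq> []" using that by auto
    ultimately obtain u M v where p: "p = u @ M # v" "\<forall>x\<in>set u \<union> set v. x < M"
      by (rule distinct_split_max)
    have "M = m" using that p by (auto simp: stack_sort_max)
    moreover have "x \<in> set p" using that assms by (metis UnI1 set_append set_stack_sort)
    ultimately have "x = m \<or> x < m" using p by auto
    then show False using assms(3) by auto
  qed
  then have "{p. stack_sort p = w @ [m]} = {}" by blast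
  then show ?thesis unfolding preimage_poly_altdef by (metis sum.empty)
qed

lemma preimage_poly_single: "preimage_poly [m] = x_var * y_var"
proof -
  have "p = [m]" if "stack_sort p = [m]" for p
    using that by (metis mset_stack_sort mset_single_iff_right mset.simps(1,2))
  moreover have "stack_sort [m] = [m]" by (simp add: stack_sort_def)
  ultimately have "{p. stack_sort p = [m]} = {[m]}" by blast
  then show ?thesis unfolding preimage_poly_altdef by (simp add: des_Cons)
qed

text \<open>A preimage is \<open>u @ m # v\<close> where the images of \<open>u\<close> and
  \<open>v\<close> concatenate to \<open>w\<close>, so it determines a cut of \<open>w\<close>. Cut
  0 puts \<open>m\<close> first, which adds a descent; the last cut puts \<open>m\<close> last,
  which adds nothing. At an inner cut the new descent and the new peak supply the extra
  \<open>x\<close> and \<open>y\<close> required by the two exponents \<open>+ 1\<close> in the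
  product.\<close>

lemma preimage_poly_max:
  assumes "distinct w" "w \<noteq> []" "\<forall>x\<in>set w. x < m"
  shows "preimage_poly (w @ [m]) = (1 + x_var) * preimage_poly w +
    (\<Sum>k\<in>{1..<length w}. preimage_poly (take k w) * preimage_poly (drop k w))"
proof -
  define wt where "wt p = x_var ^ (des p + 1) * y_var ^ (peak p + 1)" for p
  define fib where "fib w = {p. stack_sort p = w}" for w
  have fin: "finite (fib w)" for w unfolding fib_def by (rule finite_stack_sort_fibre)
  have pp: "preimage_poly w = sum wt (fib w)" for w
    unfolding preimage_poly_altdef wt_def fib_def ..
  \<comment> \<open>\<open>S k\<close> contains the pairs around \<open>m\<close> whose images meet
    at cut \<open>k\<close> of \<open>w\<close>.\<close>
  define S where "S k = fib (take k w) \<times> fib (drop k w)" for k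
  have small: "set u \<union> set v \<subseteq> set w" if "(u, v) \<in> S k" for u v k
  proof -
    have "set u = set (take k w)" "set v = set (drop k w)"
      using that set_stack_sort[of u] set_stack_sort[of v] by (simp_all add: S_def fib_def)
    then show ?thesis by (auto dest: in_set_takeD in_set_dropD)
  qed
  have fib_Nil: "fib [] = {[]}" by (auto simp: fib_def)
  let ?g = "\<lambda>(k, u, v). u @ m # v"
  let ?I = "SIGMA k:{0..length w}. S k"
  have len: "length u = k" if "k \<le> length w" "(u, v) \<in> S k" for k u v
    using that length_stack_sort[of u] by (simp add: S_def fib_def)
  have notin: "m \<notin> set u" "m \<notin> set v" if "(u, v) \<in> S k" for k u v
    using small[OF that] assms(3) by auto
  have inj: "inj_on ?g ?I"
  proof (rule inj_onI, clarsimp)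
    fix k u v k' u' v'
    assume *: "k \<le> length w" "k' \<le> length w" "(u, v) \<in> S k" "(u', v') \<in> S k'"
      "u @ m # v = u' @ m # v'"
    then have "u = u'" "v = v'" using notin append_Cons_eq_iff[of m u v u' v'] by auto
    then show "k = k' \<and> u = u' \<and> v = v'" using len * by metis
  qed
  have img: "?g ` ?I = fib (w @ [m])"
  proof (rule set_eqI, rule iffI)
    fix p assume "p \<in> ?g ` ?I"
    then obtain k u v where p: "p = u @ m # v" "(u, v) \<in> S k" by auto
    have "\<forall>x\<in>set u \<union> set v. x < m" using small[OF p(2)] assms(3) by auto
    then show "p \<in> fib (w @ [m])" using p by (auto simp: fib_def stack_sort_max S_def)
  next
    fix p assume "p \<in> fib (w @ [m])"
    then have p: "stack_sort p = w @ [m]" by (simp add: fib_def)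
    have "distinct (w @ [m])" using assms by auto
    then have "distinct p" by (metis p distinct_stack_sort)
    moreover have "p \<noteq> []" using p by auto
    ultimately obtain u M v where puv: "p = u @ M # v" "\<forall>x\<in>set u \<union> set v. x < M"
      by (rule distinct_split_max)
    then have "stack_sort u @ stack_sort v = w" "M = m" using p by (auto simp: stack_sort_max)
    then have "(u, v) \<in> S (length u)" "length u \<le> length w"
      by (auto simp: S_def fib_def)
    then show "p \<in> ?g ` ?I" using puv \<open>M = m\<close> by force
  qed
  have "preimage_poly (w @ [m]) = (\<Sum>k\<in>{0..length w}. \<Sum>(u, v)\<in>S k. wt (u @ m # v))"
    unfolding pp img[symmetric] sum.reindex[OF inj]
    by (subst sum.Sigma) (auto simp: S_def fin split_def)
  also have "{0..length w} = insert 0 (insert (length w) {1..<length w})" by auto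
  also have "(\<Sum>k\<in>\<dots>. \<Sum>(u, v)\<in>S k. wt (u @ m # v)) =
      (\<Sum>(u, v)\<in>S 0. wt (u @ m # v)) + ((\<Sum>(u, v)\<in>S (length w). wt (u @ m # v)) +
      (\<Sum>k\<in>{1..<length w}. \<Sum>(u, v)\<in>S k. wt (u @ m # v)))"
    using assms(2) by simp
  also have "(\<Sum>(u, v)\<in>S 0. wt (u @ m # v)) = x_var * preimage_poly w"
  proof -
    have "(\<Sum>(u, v)\<in>S 0. wt (u @ m # v)) = (\<Sum>v\<in>fib w. wt (m # v))"
      by (simp add: S_def fib_Nil flip: sum.cartesian_product)
    also have "\<dots> = (\<Sum>v\<in>fib w. x_var * wt v)"
    proof (rule sum.cong[OF refl])
      fix v assume "v \<in> fib w"
      then have "\<forall>x\<in>set [] \<union> set v. x < m" "v \<noteq> []" using assms by (auto simp: fib_def)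
      then show "wt (m # v) = x_var * wt v"
        using des_max[of "[]" v m] peak_max[of "[]" v m] by (simp add: wt_def ac_simps)
    qed
    finally show ?thesis by (simp add: pp sum_distrib_left)
  qed
  also have "(\<Sum>(u, v)\<in>S (length w). wt (u @ m # v)) = preimage_poly w"
  proof -
    have "(\<Sum>(u, v)\<in>S (length w). wt (u @ m # v)) = (\<Sum>u\<in>fib w. wt (u @ [m]))"
      by (simp add: S_def fib_Nil flip: sum.cartesian_product)
    also have "\<dots> = (\<Sum>u\<in>fib w. wt u)"
    proof (rule sum.cong[OF refl])
      fix u assume "u \<in> fib w"
      then have "\<forall>x\<in>set u \<union> set []. x < m" using assms by (auto simp: fib_def)
      then show "wt (u @ [m]) = wt u" by (simp add: wt_def des_max peak_max)
    qed
    finally show ?thesis by (simp add: pp)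
  qed
  also have "(\<Sum>k\<in>{1..<length w}. \<Sum>(u, v)\<in>S k. wt (u @ m # v)) =
      (\<Sum>k\<in>{1..<length w}. preimage_poly (take k w) * preimage_poly (drop k w))"
  proof (rule sum.cong[OF refl])
    fix k assume k: "k \<in> {1..<length w}"
    have "(\<Sum>(u, v)\<in>S k. wt (u @ m # v)) = (\<Sum>(u, v)\<in>S k. wt u * wt v)"
    proof (rule sum.cong[OF refl], clarify)
      fix u v assume uv: "(u, v) \<in> S k"
      then have "\<forall>x\<in>set u \<union> set v. x < m" using small[OF uv] assms(3) by auto
      moreover have "u \<noteq> []" "v \<noteq> []" using uv k by (auto simp: S_def fib_def)
      ultimately show "wt (u @ m # v) = wt u * wt v"
        by (simp add: wt_def des_max peak_max power_add ac_simps)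
    qed
    then show "(\<Sum>(u, v)\<in>S k. wt (u @ m # v)) = preimage_poly (take k w) * preimage_poly (drop k w)"
      by (simp add: S_def pp sum_product flip: sum.cartesian_product)
  qed
  finally show ?thesis by (simp add: algebra_simps)
qed

lemma preimage_poly_snoc:
  assumes "distinct (w @ [m])" "w \<noteq> []"
  shows "preimage_poly (w @ [m]) = (if \<forall>x\<in>set w. x < m then (1 + x_var) * preimage_poly w +
    (\<Sum>k\<in>{1..<length w}. preimage_poly (take k w) * preimage_poly (drop k w)) else 0)"
proof (cases "\<forall>x\<in>set w. x < m")
  case False
  then obtain x where "x \<in> set w" "\<not> x < m" by blast
  then have "m < x" using assms(1) by (metis distinct_append disjoint_iff linorder_neqE_nat list.set_intros(1))
  with \<open>x \<in> set w\<close> show ?thesis using preimage_poly_not_max[of w m x] assms by (metis False)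
qed (use preimage_poly_max assms in auto)

text \<open>The test in \<open>preimage_poly_snoc\<close> depends only on relative order, and its
  summands concern shorter words, to which the induction applies.\<close>

lemma preimage_poly_map:
  assumes "distinct w" "strict_mono_on (set w) h"
  shows "preimage_poly (map h w) = preimage_poly w"
  using assms
proof (induction "length w" arbitrary: w rule: less_induct)
  case less
  show ?case
  proof (cases w rule: rev_cases)
    case (snoc w' m)
    have mono: "strict_mono_on (set w') h"
      using less.prems snoc by (auto intro: monotone_on_subset)
    have inj: "inj_on h (set w)" using less.prems(2) by (rule strict_mono_on_imp_inj_on)
    have IH: "preimage_poly (map h v) = preimage_poly v"
      if "length v < length w" "set v \<subseteq> set w" "distinct v" for v
      using less.hyps[OF that(1,3)] less.prems(2) that(2) by (blast intro: monotone_on_subset)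
    show ?thesis
    proof (cases "w' = []")
      case False
      have "(\<forall>x\<in>set w'. h x < h m) \<longleftrightarrow> (\<forall>x\<in>set w'. x < m)"
        using strict_mono_on_less[OF less.prems(2)] snoc by auto
      moreover have "distinct (map h w)" using inj less.prems by (simp add: distinct_map)
      moreover have "preimage_poly (take k (map h w')) = preimage_poly (take k w')"
        "preimage_poly (drop k (map h w')) = preimage_poly (drop k w')" for k
        using less.prems(1) snoc unfolding take_map drop_map
        by (auto intro!: IH dest: in_set_takeD in_set_dropD)
      moreover have "preimage_poly (map h w') = preimage_poly w'"
        using less.prems(1) snoc by (auto intro!: IH)
      ultimately show ?thesis
        using preimage_poly_snoc[of w' m] preimage_poly_snoc[of "map h w'" "h m"] less.prems(1) False snoc
        by (auto)
    qed (simp add: snoc preimage_poly_single)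
  qed simp
qed

section \<open>Decomposition along hooks\<close>

text \<open>Cuts strictly inside \<open>u\<close> are separated from the others; the cut at the end
  of \<open>u\<close> is index 0 of the second sum.\<close>

lemma sum_splits_append:
  fixes f :: "'a list \<Rightarrow> 'a list \<Rightarrow> 'b::comm_monoid_add"
  assumes "u \<noteq> []"
  shows "(\<Sum>k\<in>{1..<length (u @ v)}. f (take k (u @ v)) (drop k (u @ v))) =
    (\<Sum>k\<in>{1..<length u}. f (take k u) (drop k u @ v)) +
    (\<Sum>k<length v. f (u @ take k v) (drop k v))"
proof -
  have "{1..<length (u @ v)} = {1..<length u} \<union> {length u..<length u + length v}"
    using assms by (cases u) auto
  then have "(\<Sum>k\<in>{1..<length (u @ v)}. f (take k (u @ v)) (drop k (u @ v))) =
    (\<Sum>k\<in>{1..<length u}. f (take k (u @ v)) (drop k (u @ v))) +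
    (\<Sum>k\<in>{length u..<length u + length v}. f (take k (u @ v)) (drop k (u @ v)))"
    by (simp add: sum.union_disjoint)
  also have "(\<Sum>k\<in>{length u..<length u + length v}. f (take k (u @ v)) (drop k (u @ v))) =
    (\<Sum>k<length v. f (u @ take k v) (drop k v))"
    by (rule sum.reindex_bij_witness[of _ "\<lambda>k. k + length u" "\<lambda>k. k - length u"]) auto
  finally show ?thesis by simp
qed

text \<open>Pairs \<open>j < e\<close> are re-indexed by \<open>j\<close> and the gap
  \<open>e - Suc j\<close>; this brings the hook index outside in
  \<open>preimage_poly_hooks\<close>.\<close>

lemma sum_lessThan_triangle:
  fixes f :: "nat \<Rightarrow> nat \<Rightarrow> 'a::comm_monoid_add"
  shows "(\<Sum>e<n. \<Sum>j<e. f j e) = (\<Sum>j<n. \<Sum>e<n - Suc j. f j (Suc (j + e)))"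
proof -
  have "(\<Sum>e<n. \<Sum>j<e. f j e) = (\<Sum>(e, j)\<in>(SIGMA e:{..<n}. {..<e}). f j e)"
    by (subst sum.Sigma) auto
  also have "\<dots> = (\<Sum>(j, e)\<in>(SIGMA j:{..<n}. {..<n - Suc j}). f j (Suc (j + e)))"
    by (rule sum.reindex_bij_witness[of _ "\<lambda>(j, e). (Suc (j + e), j)" "\<lambda>(e, j). (j, e - Suc j)"]) auto
  also have "\<dots> = (\<Sum>j<n. \<Sum>e<n - Suc j. f j (Suc (j + e)))"
    by (subst sum.Sigma) auto
  finally show ?thesis .
qed

text \<open>The term with index \<open>j\<close> belongs to the hook from \<open>m\<close> to \<open>t ! j\<close>.\<close>

lemma preimage_poly_hooks:
  assumes "distinct (l @ m # r @ t)" "\<forall>x\<in>set l \<union> set r. x < m" "r \<noteq> []"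
    and "sorted_wrt (<) (m # t)"
  shows "preimage_poly (l @ m # r @ t) =
    (\<Sum>j<length t. preimage_poly (l @ m # drop (Suc j) t) * preimage_poly (r @ take j t))"
  using assms
proof (induction "length t" arbitrary: l t rule: less_induct)
  case less
  show ?case
  proof (cases t rule: rev_cases)
    \<comment> \<open>Without a tail the word ends in a letter of \<open>r\<close>, which is below
      \<open>m\<close>, so its fibre is empty like the sum.\<close>
    case Nil
    obtain r' z where "r = r' @ [z]" using less.prems(3) by (cases r rule: rev_cases) auto
    then show ?thesis
      using Nil less.prems preimage_poly_not_max[of "l @ m # r'" z m] by auto
  next
    case (snoc t' z)
    let ?F = preimage_poly and ?u = "l @ [m]"
    have zmax: "\<forall>x\<in>set l \<union> set r \<union> set t' \<union> {m}. x < z"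
      using less.prems(2,4) unfolding snoc by (auto simp: sorted_wrt_append dest: less_trans)
    \<comment> \<open>A cut inside \<open>l\<close> leaves a suffix of \<open>l\<close> on the
      right, and a cut inside the tail leaves a prefix of the tail on the left. Hence the hypothesis
      is needed for all such affixes.\<close>
    have IH: "?F (l' @ m # r @ t'') =
        (\<Sum>j<length t''. ?F (l' @ m # drop (Suc j) t'') * ?F (r @ take j t''))"
      if affixes: "suffix l' l" "prefix t'' t'" for l' t''
    proof (rule less.hyps)
      obtain a b where ab: "l = a @ l'" "t' = t'' @ b" using affixes unfolding suffix_def prefix_def by blast
      show "length t'' < length t" using ab snoc by simp
      show "distinct (l' @ m # r @ t'')" "\<forall>x\<in>set l' \<union> set r. x < m"
        "sorted_wrt (<) (m # t'')"
        using less.prems ab snoc by (auto simp: sorted_wrt_append)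
    qed fact
    \<comment> \<open>A left factor that ends inside \<open>r\<close> contains the larger letter
      \<open>m\<close> before its end.\<close>
    have rzero: "?F (?u @ take e r) = 0" if "0 < e" for e
    proof -
      obtain q x where q: "take e r = q @ [x]"
        using less.prems(3) \<open>0 < e\<close> by (cases "take e r" rule: rev_cases) auto
      have "x \<in> set r" using in_set_takeD[of x e r] q by simp
      have "distinct (?u @ take e r)"
        using less.prems(1) by (auto dest: in_set_takeD)
      then show ?thesis
        using preimage_poly_not_max[of "?u @ q" x m] less.prems(2) \<open>x \<in> set r\<close> q by auto
    qed
    \<comment> \<open>Removal of the final maximum \<open>z\<close>, with the cuts sorted by whether
      they fall before or after \<open>m\<close>. It is used both for the whole word and for the
      words on the right-hand side of the claim.\<close>
    have rec: "?F (?u @ v @ [z]) = (1 + x_var) * ?F (?u @ v) +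
        (\<Sum>k\<in>{1..<length ?u}. ?F (take k ?u) * ?F (drop k ?u @ v)) +
        (\<Sum>k<length v. ?F (?u @ take k v) * ?F (drop k v))"
      if "set v \<subseteq> set r \<union> set t'" "distinct v" for v
    proof -
      have "?F ((?u @ v) @ [z]) = (1 + x_var) * ?F (?u @ v) +
        (\<Sum>k\<in>{1..<length (?u @ v)}. ?F (take k (?u @ v)) * ?F (drop k (?u @ v)))"
        by (rule preimage_poly_max) (use that less.prems zmax snoc in auto)
      then show ?thesis
        using sum_splits_append[of ?u "\<lambda>u v. ?F u * ?F v" v] by (simp add: add.assoc)
    qed
    \<comment> \<open>Of the cuts after \<open>m\<close>, the one directly behind \<open>m\<close>
      is kept apart, those inside \<open>r\<close> vanish by \<open>rzero\<close>, and the others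
      leave all of \<open>r\<close> on the left.\<close>
    have third: "(\<Sum>k<length (r @ t'). ?F (?u @ take k (r @ t')) * ?F (drop k (r @ t'))) =
      ?F ?u * ?F (r @ t') + (\<Sum>e<length t'. ?F (?u @ r @ take e t') * ?F (drop e t'))"
    proof -
      have "{..<length (r @ t')} = {0} \<union> {1..<length r} \<union> {length r..<length (r @ t')}"
        using less.prems(3) by auto
      then have "(\<Sum>k<length (r @ t'). ?F (?u @ take k (r @ t')) * ?F (drop k (r @ t'))) =
        ?F ?u * ?F (r @ t') +
        (\<Sum>k\<in>{1..<length r}. ?F (?u @ take k (r @ t')) * ?F (drop k (r @ t'))) +
        (\<Sum>k\<in>{length r..<length (r @ t')}. ?F (?u @ take k (r @ t')) * ?F (drop k (r @ t')))"
        using less.prems(3) by (simp add: sum.union_disjoint)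
      also have "(\<Sum>k\<in>{1..<length r}. ?F (?u @ take k (r @ t')) * ?F (drop k (r @ t'))) = 0"
        using rzero by (intro sum.neutral) auto
      also have "(\<Sum>k\<in>{length r..<length (r @ t')}. ?F (?u @ take k (r @ t')) * ?F (drop k (r @ t'))) =
        (\<Sum>e<length t'. ?F (?u @ r @ take e t') * ?F (drop e t'))"
        by (rule sum.reindex_bij_witness[of _ "\<lambda>k. k + length r" "\<lambda>k. k - length r"]) auto
      finally show ?thesis by simp
    qed
    let ?n = "length t'"
    let ?v = "\<lambda>j. drop (Suc j) t'"
    \<comment> \<open>The left factors end in a prefix of the tail, so the hypothesis expands them;
      then the hook index \<open>j\<close> becomes the outer one.\<close>
    have fourth: "(\<Sum>e<?n. ?F (?u @ r @ take e t') * ?F (drop e t')) =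
      (\<Sum>j<?n. \<Sum>e<?n - Suc j. ?F (?u @ take e (?v j)) * ?F (drop e (?v j)) * ?F (r @ take j t'))"
    proof -
      have "(\<Sum>e<?n. ?F (?u @ r @ take e t') * ?F (drop e t')) =
        (\<Sum>e<?n. \<Sum>j<e. ?F (?u @ drop (Suc j) (take e t')) * ?F (r @ take j t') * ?F (drop e t'))"
      proof (rule sum.cong[OF refl])
        fix e assume "e \<in> {..<?n}"
        then show "?F (?u @ r @ take e t') * ?F (drop e t') =
          (\<Sum>j<e. ?F (?u @ drop (Suc j) (take e t')) * ?F (r @ take j t') * ?F (drop e t'))"
          using IH[of l "take e t'"] by (simp add: take_is_prefix sum_distrib_right min_def)
      qed
      also have "\<dots> = (\<Sum>j<?n. \<Sum>e<?n - Suc j.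
        ?F (?u @ take e (?v j)) * ?F (drop e (?v j)) * ?F (r @ take j t'))"
        unfolding sum_lessThan_triangle by (intro sum.cong refl) (simp add: drop_take ac_simps)
      finally show ?thesis .
    qed
    \<comment> \<open>Here the right factors contain a suffix of \<open>l\<close> and all of
      \<open>t'\<close>, and the hypothesis expands them.\<close>
    have first: "(\<Sum>k\<in>{1..<length ?u}. ?F (take k ?u) * ?F (drop k ?u @ r @ t')) =
      (\<Sum>j<?n. (\<Sum>k\<in>{1..<length ?u}. ?F (take k ?u) * ?F (drop k ?u @ ?v j)) * ?F (r @ take j t'))"
    proof -
      have "(\<Sum>k\<in>{1..<length ?u}. ?F (take k ?u) * ?F (drop k ?u @ r @ t')) =
        (\<Sum>k\<in>{1..<length ?u}. \<Sum>j<?n. ?F (take k ?u) * ?F (drop k ?u @ ?v j) * ?F (r @ take j t'))"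
      proof (rule sum.cong[OF refl])
        fix k assume "k \<in> {1..<length ?u}"
        then show "?F (take k ?u) * ?F (drop k ?u @ r @ t') =
          (\<Sum>j<?n. ?F (take k ?u) * ?F (drop k ?u @ ?v j) * ?F (r @ take j t'))"
          using IH[of "drop k l" t'] by (simp add: suffix_drop sum_distrib_left mult.assoc)
      qed
      also have "\<dots> = (\<Sum>j<?n. \<Sum>k\<in>{1..<length ?u}.
          ?F (take k ?u) * ?F (drop k ?u @ ?v j) * ?F (r @ take j t'))"
        by (rule sum.swap)
      finally show ?thesis by (simp only: sum_distrib_right)
    qed
    have step: "?F (?u @ ?v j @ [z]) * ?F (r @ take j t') =
        (1 + x_var) * (?F (?u @ ?v j) * ?F (r @ take j t')) +
        (\<Sum>k\<in>{1..<length ?u}. ?F (take k ?u) * ?F (drop k ?u @ ?v j)) * ?F (r @ take j t') +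
        (\<Sum>e<?n - Suc j. ?F (?u @ take e (?v j)) * ?F (drop e (?v j)) * ?F (r @ take j t'))" for j
    proof -
      have "set (?v j) \<subseteq> set r \<union> set t'" "distinct (?v j)"
        using less.prems snoc by (auto dest: in_set_dropD)
      from rec[OF this] show ?thesis by (simp add: distrib_right sum_distrib_right mult.assoc)
    qed
    have "?F (l @ m # r @ t) = (1 + x_var) * ?F (?u @ r @ t') +
        (\<Sum>k\<in>{1..<length ?u}. ?F (take k ?u) * ?F (drop k ?u @ r @ t')) +
        (\<Sum>k<length (r @ t'). ?F (?u @ take k (r @ t')) * ?F (drop k (r @ t')))"
      using rec[of "r @ t'"] less.prems snoc by auto
    also have "?F (?u @ r @ t') = (\<Sum>j<?n. ?F (?u @ ?v j) * ?F (r @ take j t'))"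
      using IH[of l t'] by simp
    \<comment> \<open>For each \<open>j < ?n\<close>, \<open>step\<close> reassembles the terms with
      \<open>1 + x_var\<close> and those from \<open>first\<close> and \<open>fourth\<close>. The
      product left over from \<open>third\<close> is the hook from \<open>m\<close> to
      \<open>z\<close>.\<close>
    finally have "?F (l @ m # r @ t) =
      (\<Sum>j<?n. ?F (?u @ ?v j @ [z]) * ?F (r @ take j t')) + ?F ?u * ?F (r @ t')"
      unfolding first third fourth step by (simp add: sum.distrib sum_distrib_left)
    then show ?thesis using snoc by simp
  qed
qed

section \<open>Binary plane trees\<close>

text \<open>The exponents follow \<open>L_poly\<close>, where index \<open>i\<close> stands for
  \<open>i - 1\<close> right edges. A sum over trees instead of coefficients allows a decomposition
  at the root.\<close>

definition tree_poly :: "nat \<Rightarrow> poly_xy" where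
  "tree_poly r = (\<Sum>t | size (t :: unit tree) = r. x_var ^ (right_edges t + 1) * y_var ^ num_leaves t)"

lemma trees_size_Suc:
  "{t :: unit tree. size t = Suc r} =
    (\<lambda>(k, u, v). Node u () v) ` (SIGMA k:{..r}. {t. size t = k} \<times> {t. size t = r - k})"
proof (rule set_eqI, rule iffI)
  fix t :: "unit tree" assume "t \<in> {t. size t = Suc r}"
  then show "t \<in> (\<lambda>(k, u, v). Node u () v) ` (SIGMA k:{..r}. {t. size t = k} \<times> {t. size t = r - k})"
  proof (cases t)
    case (Node u a v)
    have "(size u, u, v) \<in> (SIGMA k:{..r}. {t. size t = k} \<times> {t. size t = r - k})"
      using \<open>t \<in> _\<close> Node by auto
    then show ?thesis using Node by (auto simp: image_iff intro!: bexI)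
  qed (use \<open>t \<in> _\<close> in simp)
qed auto

lemma finite_trees_size: "finite {t :: unit tree. size t = r}"
proof (induction r rule: less_induct)
  case (less r)
  show ?case
  proof (cases r)
    case 0
    then have "{t :: unit tree. size t = r} = {Leaf}" by auto
    then show ?thesis by simp
  next
    case (Suc q)
    then show ?thesis unfolding Suc trees_size_Suc
      by (intro finite_imageI finite_SigmaI finite_cartesian_product less) (auto simp: Suc)
  qed
qed

lemma tree_poly_Suc_0: "tree_poly (Suc 0) = x_var * y_var"
proof -
  have "{t :: unit tree. size t = Suc 0} = {Node Leaf () Leaf}"
  proof (intro set_eqI iffI)
    fix t :: "unit tree" assume "t \<in> {t. size t = Suc 0}"
    then show "t \<in> {Node Leaf () Leaf}" by (cases t) auto
  qed auto
  then show ?thesis by (simp add: tree_poly_def)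
qed

text \<open>The root is not a leaf. With only a right child it adds one right edge, with only a left
  child it adds nothing, and with two children its right edge supplies the extra \<open>x\<close> in
  the product. The result is the recursion of \<open>preimage_poly_max\<close>.\<close>

lemma tree_poly_Suc:
  assumes "0 < r"
  shows "tree_poly (Suc r) = (1 + x_var) * tree_poly r +
    (\<Sum>k\<in>{1..<r}. tree_poly k * tree_poly (r - k))"
proof -
  let ?w = "\<lambda>t :: unit tree. x_var ^ (right_edges t + 1) * y_var ^ num_leaves t"
  let ?T = "\<lambda>k. {t :: unit tree. size t = k}"
  have size0: "?T 0 = {Leaf}" by auto
  have inj: "inj_on (\<lambda>(k, u, v). Node u () v) (SIGMA k:{..r}. ?T k \<times> ?T (r - k))"
    by (auto simp: inj_on_def)
  have "tree_poly (Suc r) = (\<Sum>k\<le>r. \<Sum>(u, v)\<in>?T k \<times> ?T (r - k). ?w (Node u () v))"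
    unfolding tree_poly_def trees_size_Suc sum.reindex[OF inj]
    by (subst sum.Sigma) (auto simp: finite_trees_size split_def)
  also have "{..r} = insert 0 (insert r {1..<r})" by auto
  also have "(\<Sum>k\<in>\<dots>. \<Sum>(u, v)\<in>?T k \<times> ?T (r - k). ?w (Node u () v)) =
      (\<Sum>(u, v)\<in>?T 0 \<times> ?T r. ?w (Node u () v)) + ((\<Sum>(u, v)\<in>?T r \<times> ?T 0. ?w (Node u () v)) +
      (\<Sum>k\<in>{1..<r}. \<Sum>(u, v)\<in>?T k \<times> ?T (r - k). ?w (Node u () v)))"
    using assms by simp
  also have "(\<Sum>(u, v)\<in>?T 0 \<times> ?T r. ?w (Node u () v)) = x_var * tree_poly r"
  proof -
    have "(\<Sum>(u, v)\<in>?T 0 \<times> ?T r. ?w (Node u () v)) = (\<Sum>v\<in>?T r. ?w (Node Leaf () v))"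
      unfolding size0 by (simp flip: sum.cartesian_product)
    also have "\<dots> = (\<Sum>v\<in>?T r. x_var * ?w v)"
      using assms by (intro sum.cong) (auto simp: ac_simps)
    finally show ?thesis by (simp add: tree_poly_def sum_distrib_left)
  qed
  also have "(\<Sum>(u, v)\<in>?T r \<times> ?T 0. ?w (Node u () v)) = tree_poly r"
  proof -
    have "(\<Sum>(u, v)\<in>?T r \<times> ?T 0. ?w (Node u () v)) = (\<Sum>u\<in>?T r. ?w (Node u () Leaf))"
      unfolding size0 by (simp flip: sum.cartesian_product)
    also have "\<dots> = (\<Sum>u\<in>?T r. ?w u)"
      using assms by (intro sum.cong) auto
    finally show ?thesis by (simp add: tree_poly_def)
  qed
  also have "(\<Sum>k\<in>{1..<r}. \<Sum>(u, v)\<in>?T k \<times> ?T (r - k). ?w (Node u () v)) =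
      (\<Sum>k\<in>{1..<r}. tree_poly k * tree_poly (r - k))"
  proof (rule sum.cong[OF refl])
    fix k assume k: "k \<in> {1..<r}"
    have "(\<Sum>(u, v)\<in>?T k \<times> ?T (r - k). ?w (Node u () v)) = (\<Sum>(u, v)\<in>?T k \<times> ?T (r - k). ?w u * ?w v)"
      using k by (intro sum.cong) (auto simp: power_add ac_simps)
    then show "(\<Sum>(u, v)\<in>?T k \<times> ?T (r - k). ?w (Node u () v)) = tree_poly k * tree_poly (r - k)"
      by (simp add: tree_poly_def sum_product flip: sum.cartesian_product)
  qed
  finally show ?thesis by (simp add: algebra_simps)
qed

lemma right_edges_less_size: "t \<noteq> Leaf \<Longrightarrow> right_edges t < size t"
  by (induction t) (auto split: if_splits, fastforce+)

lemma num_leaves_bounds: "t \<noteq> Leaf \<Longrightarrow> 1 \<le> num_leaves t \<and> num_leaves t \<le> size t"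
proof (induction t)
  case (Node u a v)
  then show ?case by (cases "u = Leaf"; cases "v = Leaf") auto
qed simp

text \<open>Trees are grouped by their two statistics; the bounds on these show that the index box
  \<open>{1..r} \<times> {1..r}\<close> misses no tree.\<close>

lemma L_poly_eq_tree_poly:
  assumes "0 < r"
  shows "L_poly r = tree_poly r"
proof -
  let ?T = "{t :: unit tree. size t = r}"
  let ?h = "\<lambda>t :: unit tree. (right_edges t + 1, num_leaves t)"
  have "tree_poly r = (\<Sum>p\<in>{1..r} \<times> {1..r}. \<Sum>t\<in>{t \<in> ?T. ?h t = p}.
      x_var ^ (right_edges t + 1) * y_var ^ num_leaves t)"
    unfolding tree_poly_def
  proof (rule sum.group[symmetric])
    show "?h ` ?T \<subseteq> {1..r} \<times> {1..r}"
    proof (intro image_subsetI)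
      fix t :: "unit tree" assume "t \<in> ?T"
      then have "t \<noteq> Leaf" "size t = r" using assms by auto
      then show "?h t \<in> {1..r} \<times> {1..r}"
        using num_leaves_bounds[of t] right_edges_less_size[of t] by auto
    qed
  qed (auto simp: finite_trees_size)
  also have "\<dots> = (\<Sum>p\<in>{1..r} \<times> {1..r}. of_nat (L_num r (fst p) (snd p)) * x_var ^ fst p * y_var ^ snd p)"
  proof (rule sum.cong[OF refl])
    fix p assume p: "p \<in> {1..r} \<times> {1..r}"
    have "{t \<in> ?T. ?h t = p} = {t. size t = r \<and> right_edges t = fst p - 1 \<and> num_leaves t = snd p}"
      using p by (cases p) auto
    then have "L_num r (fst p) (snd p) = card {t \<in> ?T. ?h t = p}"
      by (simp only: L_num_def)
    moreover have "(\<Sum>t\<in>{t \<in> ?T. ?h t = p}. x_var ^ (right_edges t + 1) * y_var ^ num_leaves t) =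
      (\<Sum>t\<in>{t \<in> ?T. ?h t = p}. x_var ^ fst p * y_var ^ snd p)"
      by (rule sum.cong) auto
    ultimately show "(\<Sum>t\<in>{t \<in> ?T. ?h t = p}. x_var ^ (right_edges t + 1) * y_var ^ num_leaves t) =
      of_nat (L_num r (fst p) (snd p)) * x_var ^ fst p * y_var ^ snd p"
      by (simp only: mult.assoc sum_constant)
  qed
  finally show ?thesis by (simp add: L_poly_def sum.cartesian_product split_def)
qed

text \<open>All factors of an increasing word are increasing, so \<open>preimage_poly_max\<close>
  becomes a recursion in the length alone, the same as \<open>tree_poly_Suc\<close>.\<close>

lemma preimage_poly_increasing:
  assumes "sorted_wrt (<) w" "w \<noteq> []"
  shows "preimage_poly w = L_poly (length w)"
proof -
  have "preimage_poly w = tree_poly (length w)"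
    using assms
  proof (induction "length w" arbitrary: w rule: less_induct)
    case less
    show ?case
    proof (cases w rule: rev_cases)
      case (snoc w' m)
      show ?thesis
      proof (cases "w' = []")
        case True
        then show ?thesis by (simp add: snoc preimage_poly_single tree_poly_Suc_0)
      next
        case False
        have srt: "sorted_wrt (<) w'" "\<forall>x\<in>set w'. x < m"
          using less.prems snoc by (auto simp: sorted_wrt_append)
        have IH: "preimage_poly v = tree_poly (length v)"
          if "sorted_wrt (<) v" "v \<noteq> []" "length v \<le> length w'" for v
          using less.hyps[of v] that snoc by simp
        have "preimage_poly w = (1 + x_var) * preimage_poly w' +
          (\<Sum>k\<in>{1..<length w'}. preimage_poly (take k w') * preimage_poly (drop k w'))"
          unfolding snoc using srt False
          by (intro preimage_poly_max) (auto simp: strict_sorted_iff)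
        also have "(\<Sum>k\<in>{1..<length w'}. preimage_poly (take k w') * preimage_poly (drop k w')) =
          (\<Sum>k\<in>{1..<length w'}. tree_poly k * tree_poly (length w' - k))"
        proof (rule sum.cong[OF refl])
          fix k assume "k \<in> {1..<length w'}"
          moreover from this have "take k w' \<noteq> []" by auto
          ultimately show "preimage_poly (take k w') * preimage_poly (drop k w') =
              tree_poly k * tree_poly (length w' - k)"
            using IH[of "take k w'"] IH[of "drop k w'"] srt(1)
            by (simp add: sorted_wrt_take sorted_wrt_drop min_def)
        qed
        also have "preimage_poly w' = tree_poly (length w')" using IH[OF srt(1) False] by simp
        finally show ?thesis using False by (simp add: snoc tree_poly_Suc)
      qed
    qed (use less in simp)
  qed
  then show ?thesis using assms(2) by (simp add: L_poly_eq_tree_poly)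
qed

section \<open>The pattern 231 and legal spaces\<close>

text \<open>The list recursion makes the rules for concatenation easy inductions;
  \<open>precedes_iff_nth\<close> and \<open>straddles_iff_nth\<close> return to the indices of
  \<open>legal_space_def\<close>.\<close>

fun precedes :: "'a list \<Rightarrow> 'a \<Rightarrow> 'a \<Rightarrow> bool" where
  "precedes [] c a \<longleftrightarrow> False"
| "precedes (x # w) c a \<longleftrightarrow> c = x \<and> a \<in> set w \<or> precedes w c a"

text \<open>For \<open>a < c\<close> this is an occurrence of the pattern 231 in which \<open>c\<close> plays 2 and \<open>a\<close> plays 1.\<close>

fun straddles :: "'a::linorder list \<Rightarrow> 'a \<Rightarrow> 'a \<Rightarrow> bool" where
  "straddles [] c a \<longleftrightarrow> False"
| "straddles (x # w) c a \<longleftrightarrow> c = x \<and> (\<exists>d>c. precedes w d a) \<or> straddles w c a"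

lemma precedes_append:
  "precedes (u @ v) c a \<longleftrightarrow> precedes u c a \<or> precedes v c a \<or> c \<in> set u \<and> a \<in> set v"
  by (induction u) auto

lemma straddles_append:
  "straddles (u @ v) c a \<longleftrightarrow> straddles u c a \<or> straddles v c a \<or>
    c \<in> set u \<and> (\<exists>d>c. precedes v d a) \<or> (\<exists>d>c. precedes u c d) \<and> a \<in> set v"
  by (induction u) (auto simp: precedes_append)

lemma precedes_in_set: "precedes w c a \<Longrightarrow> c \<in> set w \<and> a \<in> set w"
  by (induction w) auto

lemma straddles_in_set: "straddles w c a \<Longrightarrow> c \<in> set w \<and> a \<in> set w"
  by (induction w) (auto dest: precedes_in_set)

lemma precedes_map: "precedes (map h w) c a \<longleftrightarrow> (\<exists>c' a'. c = h c' \<and> a = h a' \<and> precedes w c' a')"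
  by (induction w) auto

lemma straddles_map:
  assumes "strict_mono_on (set w) h"
  shows "straddles (map h w) c a \<longleftrightarrow> (\<exists>c' a'. c = h c' \<and> a = h a' \<and> straddles w c' a')"
  using assms
proof (induction w)
  case (Cons x w)
  have "strict_mono_on (set w) h" using Cons.prems by (auto intro: monotone_on_subset)
  moreover have "(\<exists>d>h x. precedes (map h w) d a) \<longleftrightarrow> (\<exists>a'. a = h a' \<and> (\<exists>d>x. precedes w d a'))"
  proof -
    have "h d > h x \<longleftrightarrow> d > x" if "d \<in> set w" for d
      using strict_mono_on_less[OF Cons.prems] that by simp
    then show ?thesis unfolding precedes_map by (metis precedes_in_set)
  qed
  ultimately show ?case using Cons.IH by auto
qed simp

lemma sorted_iff_precedes: "sorted w \<longleftrightarrow> (\<forall>c a. precedes w c a \<longrightarrow> c \<le> a)"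
  by (induction w) auto

text \<open>As \<open>a < c\<close>, the letter \<open>m\<close> can only play the 3. It does so for
  every \<open>c\<close> on its left and every smaller \<open>a\<close> on its right.\<close>

lemma straddles_max:
  assumes "\<forall>x\<in>set u \<union> set v. x < m" "a < c"
  shows "straddles (u @ m # v) c a \<longleftrightarrow>
    straddles u c a \<or> straddles v c a \<or> c \<in> set u \<and> a \<in> set v"
proof -
  have "straddles (m # v) c a \<longleftrightarrow> straddles v c a"
    using assms(1) by (simp, meson UnI2 less_asym precedes_in_set)
  moreover have "(\<exists>d>c. precedes (m # v) d a) \<longleftrightarrow> a \<in> set v" if "c \<in> set u"
    using assms(1) that by (auto dest: precedes_in_set)
  moreover have "c \<in> set u \<and> a \<in> set v" if "precedes u c d" "a \<in> set (m # v)" for d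
  proof -
    have "c \<in> set u" using precedes_in_set[OF that(1)] by simp
    then have "c < m" using assms(1) by simp
    then have "a \<noteq> m" using assms(2) by auto
    then show ?thesis using \<open>c \<in> set u\<close> that(2) by simp
  qed
  ultimately show ?thesis unfolding straddles_append by blast
qed

text \<open>Inversions of the sorted image are the outer pairs of 231 patterns: by
  \<open>stack_sort_max\<close> and \<open>straddles_max\<close> both sides obey the same recursion
  at the maximum.\<close>

lemma precedes_stack_sort:
  assumes "distinct w" "a < c"
  shows "precedes (stack_sort w) c a \<longleftrightarrow> straddles w c a"
  using assms
proof (induction rule: distinct_max_induct)
  case (Max u m v)
  have "precedes (stack_sort u @ stack_sort v @ [m]) c a \<longleftrightarrow>
      precedes (stack_sort u) c a \<or> precedes (stack_sort v) c a \<or> c \<in> set u \<and> a \<in> set v"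
  proof -
    have "a \<noteq> m" if "c \<in> set u \<union> set v"
      using bspec[OF Max.hyps(2) that] Max.prems by auto
    then show ?thesis by (auto simp: precedes_append)
  qed
  then show ?case
    using straddles_max[OF Max.hyps(2) Max.prems] Max.IH Max.prems Max.hyps(2)
    by (simp add: stack_sort_max)
qed simp

text \<open>The maximum is emitted last, so it follows every other letter. This tells which letters
  of the left block can play 2 with a 3 from the same block.\<close>

lemma precedes_stack_sort_Max:
  assumes "distinct w"
  shows "(\<exists>d>c. precedes (stack_sort w) c d) \<longleftrightarrow> c \<in> set w \<and> c < Max (set w)"
proof
  assume "\<exists>d>c. precedes (stack_sort w) c d"
  then obtain d where "c < d" "c \<in> set w" "d \<in> set w" by (auto dest: precedes_in_set)
  then show "c \<in> set w \<and> c < Max (set w)" using Max_ge[of "set w" d] by (auto intro: less_le_trans)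
next
  assume c: "c \<in> set w \<and> c < Max (set w)"
  then have "w \<noteq> []" by auto
  then obtain u m v where w: "w = u @ m # v" "\<forall>x\<in>set u \<union> set v. x < m"
    using distinct_split_max[OF assms] by blast
  have "Max (set w) = m" using w by (intro Max_eqI) (auto intro: less_imp_le)
  then show "\<exists>d>c. precedes (stack_sort w) c d"
    using c w by (auto simp: stack_sort_max precedes_append intro!: exI[of _ m])
qed

text \<open>Knuth's criterion: no inversions in the image means no pattern 231 in the word.\<close>

lemma sorted_stack_sort:
  assumes "distinct w"
  shows "sorted (stack_sort w) \<longleftrightarrow> (\<forall>c a. a < c \<longrightarrow> \<not> straddles w c a)"
  unfolding sorted_iff_precedes
  using precedes_stack_sort[OF assms] by (metis linorder_not_le)

lemma precedes_iff_nth: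
  "precedes w c a \<longleftrightarrow> (\<exists>i j. i < j \<and> j < length w \<and> w ! i = c \<and> w ! j = a)"
proof (induction w)
  case (Cons x w)
  show ?case
  proof
    assume "precedes (x # w) c a"
    then consider "c = x" "a \<in> set w" | "precedes w c a" by auto
    then show "\<exists>i j. i < j \<and> j < length (x # w) \<and> (x # w) ! i = c \<and> (x # w) ! j = a"
    proof cases
      case 1
      then obtain j where "j < length w" "w ! j = a" by (auto simp: in_set_conv_nth)
      then show ?thesis using 1 by (intro exI[of _ 0] exI[of _ "Suc j"]) auto
    next
      case 2
      then obtain i j where "i < j" "j < length w" "w ! i = c" "w ! j = a" using Cons.IH by auto
      then show ?thesis by (intro exI[of _ "Suc i"] exI[of _ "Suc j"]) auto
    qed
  next
    assume "\<exists>i j. i < j \<and> j < length (x # w) \<and> (x # w) ! i = c \<and> (x # w) ! j = a"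
    then obtain i j where ij: "i < Suc j" "j < length w" "(x # w) ! i = c" "w ! j = a"
      by (metis Suc_less_eq less_imp_Suc_add length_Cons nth_Cons_Suc)
    then show "precedes (x # w) c a" by (cases i) (auto simp: Cons.IH)
  qed
qed simp

lemma straddles_iff_nth:
  "straddles w c a \<longleftrightarrow>
    (\<exists>i j k. i < j \<and> j < k \<and> k < length w \<and> w ! i = c \<and> c < w ! j \<and> w ! k = a)"
proof (induction w)
  case (Cons x w)
  show ?case
  proof
    assume "straddles (x # w) c a"
    then consider "c = x" "\<exists>d>c. precedes w d a" | "straddles w c a" by auto
    then show "\<exists>i j k. i < j \<and> j < k \<and> k < length (x # w) \<and> (x # w) ! i = c \<and> c < (x # w) ! j \<and>
      (x # w) ! k = a"
    proof cases
      case 1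
      then obtain j k where "j < k" "k < length w" "w ! j > c" "w ! k = a"
        by (auto simp: precedes_iff_nth)
      then show ?thesis using 1 by (intro exI[of _ 0] exI[of _ "Suc j"] exI[of _ "Suc k"]) auto
    next
      case 2
      then obtain i j k where "i < j" "j < k" "k < length w" "w ! i = c" "w ! j > c" "w ! k = a"
        using Cons.IH by auto
      then show ?thesis by (intro exI[of _ "Suc i"] exI[of _ "Suc j"] exI[of _ "Suc k"]) auto
    qed
  next
    assume "\<exists>i j k. i < j \<and> j < k \<and> k < length (x # w) \<and> (x # w) ! i = c \<and> c < (x # w) ! j \<and>
      (x # w) ! k = a"
    then obtain i j k where *: "i < j" "j < k" "k < length (x # w)" "(x # w) ! i = c"
      "c < (x # w) ! j" "(x # w) ! k = a" by blast
    from *(1,2) obtain j' k' where "j = Suc j'" "k = Suc k'"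
      by (metis less_imp_Suc_add)
    with * have ijk: "i < Suc j'" "j' < k'" "k' < length w" "(x # w) ! i = c" "c < w ! j'" "w ! k' = a"
      by auto
    show "straddles (x # w) c a"
    proof (cases i)
      case 0
      then show ?thesis using ijk by (auto simp: precedes_iff_nth)
    next
      case (Suc i')
      then show ?thesis using ijk by (auto simp: Cons.IH)
    qed
  qed
qed simp

section \<open>Legal spaces and two-stack-sortability\<close>

lemma legal_space_iff: "legal_space w x \<longleftrightarrow> \<not> (\<exists>c a. a \<le> x \<and> x < c \<and> straddles w c a)"
  unfolding legal_space_def straddles_iff_nth by blast

text \<open>The thresholds \<open>x\<close> and \<open>y\<close> only have to cut the corresponding
  letters in the same place.\<close>

lemma legal_space_map:
  assumes "strict_mono_on (set w) h" "\<And>v. v \<in> set w \<Longrightarrow> h v \<le> x \<longleftrightarrow> v \<le> y"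
  shows "legal_space (map h w) x \<longleftrightarrow> legal_space w y"
proof -
  have "h a \<le> x \<and> x < h c \<longleftrightarrow> a \<le> y \<and> y < c" if "straddles w c a" for c a
    using straddles_in_set[OF that] assms(2)[of a] assms(2)[of c] by auto
  then show ?thesis
    unfolding legal_space_iff straddles_map[OF assms(1)] by blast
qed

lemma legal_space_above: "\<forall>v\<in>set w. v \<le> x \<Longrightarrow> legal_space w x"
  by (auto simp: legal_space_iff dest!: straddles_in_set)

lemma legal_space_below: "\<forall>v\<in>set w. x < v \<Longrightarrow> legal_space w x"
  by (auto simp: legal_space_iff dest!: straddles_in_set)

lemma legal_space_max:
  assumes "\<forall>x\<in>set u \<union> set v. x < m"
  shows "legal_space (u @ m # v) x \<longleftrightarrow> legal_space u x \<and> legal_space v x \<and>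
    \<not> (\<exists>c\<in>set u. \<exists>a\<in>set v. a \<le> x \<and> x < c)"
  unfolding legal_space_iff using straddles_max[OF assms] by (meson le_less_trans)

text \<open>The image is the sorted \<open>u\<close>, the sorted \<open>v\<close> and
  \<open>m\<close>, and must avoid 231. Besides patterns inside one block, the 2 may come from
  \<open>u\<close> with 3 and 1 from the sorted \<open>v\<close>, which is excluded by legality, or
  2 and 3 from \<open>u\<close> with the 1 from \<open>v\<close>, which is excluded by the last
  condition.\<close>

lemma sorted_stack_sort_stack_sort_max:
  assumes "distinct (u @ m # v)" "\<forall>x\<in>set u \<union> set v. x < m"
  shows "sorted (stack_sort (stack_sort (u @ m # v))) \<longleftrightarrow>
    sorted (stack_sort (stack_sort u)) \<and> sorted (stack_sort (stack_sort v)) \<and>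
    (\<forall>x\<in>set u. legal_space v x) \<and>
    (\<forall>x\<in>set u. x < Max (set u) \<longrightarrow> (\<forall>a\<in>set v. x < a))"
proof -
  let ?s = stack_sort
  have d: "distinct u" "distinct v" "set u \<inter> set v = {}" using assms(1) by auto
  have neq: "x \<noteq> a" if "x \<in> set u" "a \<in> set v" for x a
    using that d(3) by auto
  have expand: "straddles (?s u @ ?s v @ [m]) c a \<longleftrightarrow> straddles (?s u) c a \<or> straddles (?s v) c a \<or>
      c \<in> set u \<and> (\<exists>d>c. straddles v d a) \<or> c \<in> set u \<and> c < Max (set u) \<and> a \<in> set v"
    if "a < c" for c a
  proof -
    have a: "a \<noteq> m" if "c \<in> set u \<union> set v" using bspec[OF assms(2) that] \<open>a < c\<close> by auto
    have "straddles (?s v @ [m]) c a \<longleftrightarrow> straddles (?s v) c a"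
      using a by (auto simp: straddles_append dest: precedes_in_set)
    moreover have "(\<exists>d>c. precedes (?s v @ [m]) d a) \<longleftrightarrow> (\<exists>d>c. straddles v d a)" if "c \<in> set u"
    proof -
      have "precedes (?s v @ [m]) d a \<longleftrightarrow> straddles v d a" if "c < d" for d
        using a \<open>c \<in> set u\<close> precedes_stack_sort[OF d(2) less_trans[OF \<open>a < c\<close> that]]
        by (simp add: precedes_append)
      then show ?thesis by blast
    qed
    moreover have "(\<exists>d>c. precedes (?s u) c d) \<and> a \<in> set (?s v @ [m]) \<longleftrightarrow>
        c \<in> set u \<and> c < Max (set u) \<and> a \<in> set v"
      using a by (auto simp: precedes_stack_sort_Max[OF d(1)])
    ultimately show ?thesis unfolding straddles_append[of "?s u"] by auto
  qed
  \<comment> \<open>A letter of \<open>u\<close> never equals a letter of \<open>v\<close>, which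
    turns the weak inequality in \<open>legal_space\<close> into a strict one.\<close>
  have legal: "(\<forall>x\<in>set u. legal_space v x) \<longleftrightarrow>
      \<not> (\<exists>c a. a < c \<and> c \<in> set u \<and> (\<exists>d>c. straddles v d a))"
  proof -
    have "a \<le> x \<longleftrightarrow> a < x" if "x \<in> set u" "straddles v d a" for x d a
      using neq[of x a] straddles_in_set[of v d a] that by auto
    then show ?thesis unfolding legal_space_iff by blast
  qed
  have below: "(\<forall>x\<in>set u. x < Max (set u) \<longrightarrow> (\<forall>a\<in>set v. x < a)) \<longleftrightarrow>
      \<not> (\<exists>c a. a < c \<and> c \<in> set u \<and> c < Max (set u) \<and> a \<in> set v)"
  proof -
    have "x < a \<longleftrightarrow> \<not> a < x" if "x \<in> set u" "a \<in> set v" for x a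
      using neq[OF that] by auto
    then show ?thesis by blast
  qed
  have s: "?s (u @ m # v) = ?s u @ ?s v @ [m]" using assms(2) by (rule stack_sort_max)
  then have "distinct (?s u @ ?s v @ [m])" using assms(1) by (metis distinct_stack_sort)
  then have "sorted (?s (?s (u @ m # v))) \<longleftrightarrow>
      (\<forall>c a. a < c \<longrightarrow> \<not> straddles (?s u @ ?s v @ [m]) c a)"
    unfolding s by (rule sorted_stack_sort)
  also have "\<dots> \<longleftrightarrow> (\<forall>c a. a < c \<longrightarrow> \<not> (straddles (?s u) c a \<or> straddles (?s v) c a \<or>
      c \<in> set u \<and> (\<exists>d>c. straddles v d a) \<or> c \<in> set u \<and> c < Max (set u) \<and> a \<in> set v))"
    by (intro all_cong1 imp_cong refl) (simp only: expand)
  also have "\<dots> \<longleftrightarrow>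
      (\<forall>c a. a < c \<longrightarrow> \<not> straddles (?s u) c a) \<and> (\<forall>c a. a < c \<longrightarrow> \<not> straddles (?s v) c a) \<and>
      \<not> (\<exists>c a. a < c \<and> c \<in> set u \<and> (\<exists>d>c. straddles v d a)) \<and>
      \<not> (\<exists>c a. a < c \<and> c \<in> set u \<and> c < Max (set u) \<and> a \<in> set v)"
    by fast
  finally show ?thesis
    using d sorted_stack_sort[of "?s u"] sorted_stack_sort[of "?s v"]
    by (simp only: legal below distinct_stack_sort)
qed

lemma sorted_stack_sort_stack_sort_map:
  assumes "distinct w" "strict_mono_on (set w) h"
  shows "sorted (stack_sort (stack_sort (map h w))) \<longleftrightarrow> sorted (stack_sort (stack_sort w))"
proof -
  have "stack_sort (stack_sort (map h w)) = map h (stack_sort (stack_sort w))"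
    using assms by (simp add: stack_sort_map)
  moreover have "x \<le> y \<longleftrightarrow> h x \<le> h y" if "x \<in> set w" "y \<in> set w" for x y
    using strict_mono_on_less_eq[OF assms(2)] that by simp
  ultimately show ?thesis
    by (auto simp: sorted_map intro: sorted_wrt_mono_rel[rotated])
qed

lemma perms_iff: "q \<in> perms n \<longleftrightarrow> distinct q \<and> set q = {1..n}"
  by (auto simp: permutations_of_set_def)

lemma length_perms: "q \<in> perms n \<Longrightarrow> length q = n"
  by (metis perms_iff distinct_card card_atLeastAtMost diff_Suc_1)

text \<open>Spaces up to \<open>n\<close> only see patterns whose 1 lies in \<open>q\<close>, hence
  patterns inside \<open>q\<close>. Above \<open>n\<close> the 2 lies in the increasing tail, so the
  \<open>l\<close> further spaces are all legal.\<close>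

lemma leg_append_tail:
  assumes "q \<in> perms n"
  shows "leg (q @ [n + 1..<n + l + 1]) = leg q + l"
proof -
  let ?t = "[n + 1..<n + l + 1]"
  have t: "precedes ?t c a \<Longrightarrow> c \<le> a" for c a
    using sorted_upt[of "n + 1" "n + l + 1"] unfolding sorted_iff_precedes by blast
  have t': "straddles w c a \<Longrightarrow> \<exists>d>c. precedes w d a" for w :: "nat list" and c a
    by (induction w) auto
  have "legal_space (q @ ?t) x \<longleftrightarrow> legal_space q x" if "x \<le> n" for x
    using that by (force simp: legal_space_iff straddles_append dest: straddles_in_set precedes_in_set)
  moreover have "legal_space (q @ ?t) x" if "n < x" for x
  proof -
    have "x < a" if "x < c" "straddles (q @ ?t) c a" for c a
    proof -
      have "c \<notin> set q" using \<open>n < x\<close> that(1) assms unfolding perms_iff by auto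
      then have "straddles ?t c a"
        using that(2) straddles_in_set[of q c a] precedes_in_set[of q c]
        unfolding straddles_append by blast
      then obtain d where "c < d" "precedes ?t d a" using t' by blast
      then show ?thesis using t[of d a] that(1) by simp
    qed
    then show ?thesis by (force simp: legal_space_iff)
  qed
  ultimately have "{x \<in> {0..n + l}. legal_space (q @ ?t) x} =
      {x \<in> {0..n}. legal_space q x} \<union> {n<..n + l}"
    by auto
  moreover have "card ({x \<in> {0..n}. legal_space q x} \<union> {n<..n + l}) =
      card {x \<in> {0..n}. legal_space q x} + l"
    by (subst card_Un_disjoint) auto
  ultimately show ?thesis
    using length_perms[OF assms] by (simp add: leg_def del: upt_Suc)
qed

section \<open>Words followed by an increasing tail\<close>

text \<open>The two words have the same relative order, so \<open>preimage_poly_map\<close> applies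
  to a relabelling that extends \<open>h\<close>.\<close>

lemma preimage_poly_append_tail:
  assumes "distinct u" "strict_mono_on (set u) h" "length t = length t'"
    and "sorted_wrt (<) t" "sorted_wrt (<) t'"
    and "\<And>x y. x \<in> set u \<Longrightarrow> y \<in> set t \<Longrightarrow> x < y"
    and "\<And>x y. x \<in> set u \<Longrightarrow> y \<in> set t' \<Longrightarrow> h x < y"
  shows "preimage_poly (map h u @ t') = preimage_poly (u @ t)"
proof -
  \<comment> \<open>On the tail, \<open>H\<close> matches the letters of \<open>t\<close> and
    \<open>t'\<close> position by position.\<close>
  define H where "H x = (if x \<in> set u then h x else the (map_of (zip t t') x))" for x
  have dist: "distinct t" using assms(4) by (simp add: strict_sorted_iff)
  have disj: "set u \<inter> set t = {}" using assms(6) by blast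
  have H_nth: "H (t ! i) = t' ! i" if "i < length t" for i
    using disj that assms(3) map_of_zip_nth[OF assms(3) dist, of i] by (auto simp: H_def)
  have mono: "strict_mono_on (set (u @ t)) H"
  proof (rule strict_mono_onI)
    fix x y assume xy: "x \<in> set (u @ t)" "y \<in> set (u @ t)" "x < y"
    show "H x < H y"
    proof (cases "y \<in> set u")
      case True
      then have "x \<in> set u" using assms(6)[of y x] xy by fastforce
      then show ?thesis using True assms(2) xy by (auto simp: H_def intro: strict_mono_onD)
    next
      case False
      then obtain j where j: "j < length t" "y = t ! j" using xy by (auto simp: in_set_conv_nth)
      show ?thesis
      proof (cases "x \<in> set u")
        case True
        have "t' ! j \<in> set t'" using j assms(3) by simp
        then show ?thesis using True assms(7) j by (simp add: H_nth) (simp add: H_def)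
      next
        case False
        then obtain i where i: "i < length t" "x = t ! i" using xy by (auto simp: in_set_conv_nth)
        have "i < j"
          using xy(3) i j sorted_wrt_nth_less[OF assms(4), of j i] by (metis less_asym linorder_neqE_nat)
        then show ?thesis
          using i j assms(3) sorted_wrt_nth_less[OF assms(5), of i j] by (simp add: H_nth)
      qed
    qed
  qed
  have eq: "map H (u @ t) = map h u @ t'"
    using H_nth assms(3) by (auto simp: H_def intro!: nth_equalityI)
  have "distinct (u @ t)" using assms(1) dist disj by simp
  from preimage_poly_map[OF this mono, unfolded eq] show ?thesis .
qed

lemma des_peak_poly_vimage_stack_sort:
  assumes "finite D"
  shows "des_peak_poly (stack_sort -` D) = (\<Sum>w\<in>D. preimage_poly w)"
proof -
  have "stack_sort -` D = (\<Union>w\<in>D. {p. stack_sort p = w})" by auto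
  then show ?thesis
    unfolding des_peak_poly_def preimage_poly_altdef
    by (simp only:) (rule sum.UNION_disjoint, use assms finite_stack_sort_fibre in auto)
qed

section \<open>Removal of the tail from the elements of \<open>D_set\<close>\<close>

lemma funpow_2_apply: "(f ^^ 2) x = f (f x)"
  by (simp add: numeral_2_eq_2)

lemma stack_sortable_2: "stack_sortable 2 n = {q \<in> perms n. sorted (stack_sort (stack_sort q))}"
  by (simp add: stack_sortable_def funpow_2_apply)

lemma finite_stack_sortable [simp]: "finite (stack_sortable t n)"
  by (rule finite_subset[of _ "perms n"]) (auto simp: stack_sortable_def)

text \<open>What remains of the words in \<open>D_set g l n\<close> after deletion of the last
  \<open>l\<close> letters; it no longer depends on \<open>l\<close>, see
  \<open>D_set_eq\<close>.\<close>

definition body :: "nat \<Rightarrow> nat \<Rightarrow> nat list set" where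
  "body g n = {q \<in> stack_sortable 2 n. leg q = g}"

lemma finite_body [simp]: "finite (body g n)"
  by (rule finite_subset[of _ "stack_sortable 2 n"]) (auto simp: body_def)

lemma tail_length_ge_iff:
  assumes "p \<in> perms (n + l)"
  shows "l \<le> tail_length p \<longleftrightarrow> (\<forall>j<l. p ! (n + l - j - 1) = n + l - j)"
proof -
  let ?N = "n + l"
  have len: "length p = ?N" using assms by (rule length_perms)
  show ?thesis
  proof (cases "p = [1..<?N + 1]")
    case True
    then have "tail_length p = ?N" using len by (simp add: tail_length_def)
    moreover have "p ! (?N - j - 1) = ?N - j" if "j < l" for j
      using that by (subst True) (simp del: upt_Suc)
    ultimately show ?thesis by simp
  next
    case False
    let ?P = "\<lambda>j. j < ?N \<and> p ! (?N - j - 1) \<noteq> ?N - j"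
    have tl: "tail_length p = (LEAST j. ?P j)" using False len by (simp add: tail_length_def Let_def)
    \<comment> \<open>Without a mismatch the word would be the identity; the existence makes
      \<open>LEAST\<close> meaningful.\<close>
    have ex: "\<exists>j. ?P j"
    proof (rule ccontr)
      assume none: "\<not> (\<exists>j. ?P j)"
      have "p = [1..<?N + 1]"
      proof (rule nth_equalityI)
        fix i assume "i < length p"
        then show "p ! i = [1..<?N + 1] ! i"
        proof -
          have "i < ?N" using len \<open>i < length p\<close> by simp
          then have "\<not> (?N - i - 1 < ?N \<and> p ! (?N - (?N - i - 1) - 1) \<noteq> ?N - (?N - i - 1))"
            using none by blast
          then have "p ! i = i + 1" using \<open>i < ?N\<close> by simp
          then show ?thesis using \<open>i < ?N\<close> by (simp del: upt_Suc)
        qed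
      qed (simp add: len del: upt_Suc)
      then show False using False by simp
    qed
    show ?thesis
    proof
      assume "l \<le> tail_length p"
      then have "\<not> ?P j" if "j < l" for j
        using that not_less_Least[of j ?P] tl by simp
      then show "\<forall>j<l. p ! (?N - j - 1) = ?N - j" by auto
    next
      assume *: "\<forall>j<l. p ! (?N - j - 1) = ?N - j"
      have "?P (tail_length p)" unfolding tl by (rule LeastI_ex[OF ex])
      then show "l \<le> tail_length p" using * by (meson not_le)
    qed
  qed
qed

lemma append_tail_perms:
  assumes "q \<in> perms n"
  shows "q @ [n + 1..<n + l + 1] \<in> perms (n + l)"
proof -
  have q: "distinct q" "set q = {1..n}" using assms unfolding perms_iff by blast+
  have "{1..n} \<union> {n + 1..<n + l + 1} = {1..n + l}" "{1..n} \<inter> {n + 1..<n + l + 1} = {}" by auto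
  then show ?thesis unfolding perms_iff by (simp only: q set_append distinct_append set_upt distinct_upt)
qed

lemma tail_length_ge_iff_append:
  assumes "p \<in> perms (n + l)"
  shows "l \<le> tail_length p \<longleftrightarrow> (\<exists>q\<in>perms n. p = q @ [n + 1..<n + l + 1])"
proof
  assume "l \<le> tail_length p"
  then have *: "p ! (n + l - j - 1) = n + l - j" if "j < l" for j
    using that tail_length_ge_iff[OF assms] by blast
  have len: "length p = n + l" using assms by (rule length_perms)
  have "drop n p = [n + 1..<n + l + 1]"
  proof (rule nth_equalityI)
    fix i assume "i < length (drop n p)"
    then show "drop n p ! i = [n + 1..<n + l + 1] ! i"
      using *[of "l - i - 1"] len by (simp del: upt_Suc)
  qed (simp add: len)
  then have split: "p = take n p @ [n + 1..<n + l + 1]" by (metis append_take_drop_id)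
  have d: "distinct p" "set p = {1..n + l}" using assms unfolding perms_iff by auto
  have "distinct (take n p)" "set (take n p) \<inter> {n + 1..<n + l + 1} = {}"
    "set (take n p) \<union> {n + 1..<n + l + 1} = {1..n + l}"
    using d split by (metis distinct_append, metis distinct_append set_upt, metis set_append set_upt)
  moreover from this have "set (take n p) = {1..n + l} - {n + 1..<n + l + 1}" by blast
  moreover have "{1..n + l} - {n + 1..<n + l + 1} = {1..n}" by auto
  ultimately have "take n p \<in> perms n" unfolding perms_iff by simp
  then show "\<exists>q\<in>perms n. p = q @ [n + 1..<n + l + 1]" using split by blast
next
  assume "\<exists>q\<in>perms n. p = q @ [n + 1..<n + l + 1]"
  then obtain q where q: "q \<in> perms n" "p = q @ [n + 1..<n + l + 1]" by blast
  have "p ! (n + l - j - 1) = n + l - j" if "j < l" for j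
    using that length_perms[OF q(1)] by (simp add: q(2) nth_append del: upt_Suc) arith
  then show "l \<le> tail_length p" using tail_length_ge_iff[OF assms] by blast
qed

text \<open>Each tail letter is a new maximum in last position, which \<open>stack_sort_max\<close>
  leaves in place.\<close>

lemma stack_sort_append_tail:
  assumes "\<forall>x\<in>set q. x \<le> n"
  shows "stack_sort (q @ [n + 1..<n + l + 1]) = stack_sort q @ [n + 1..<n + l + 1]"
proof (induction l)
  case (Suc l)
  have "\<forall>x\<in>set (q @ [n + 1..<n + l + 1]) \<union> set []. x < n + l + 1" using assms by auto
  then show ?case using Suc stack_sort_max[of "q @ [n + 1..<n + l + 1]" "[]" "n + l + 1"] by simp
qed simp

lemma sorted_stack_sort_stack_sort_append_tail:
  assumes "q \<in> perms n"
  shows "sorted (stack_sort (stack_sort (q @ [n + 1..<n + l + 1]))) \<longleftrightarrow>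
    sorted (stack_sort (stack_sort q))"
proof -
  have "\<forall>x\<in>set q. x \<le> n" using assms unfolding perms_iff by auto
  moreover from this have "\<forall>x\<in>set (stack_sort q). x \<le> n" by simp
  ultimately have "stack_sort (stack_sort (q @ [n + 1..<n + l + 1])) =
      stack_sort (stack_sort q) @ [n + 1..<n + l + 1]"
    using stack_sort_append_tail by metis
  then show ?thesis using \<open>\<forall>x\<in>set q. x \<le> n\<close>
    by (auto simp: sorted_append simp del: upt_Suc)
qed

lemma D_set_eq: "D_set g l n = (\<lambda>q. q @ [n + 1..<n + l + 1]) ` body g n"
proof (rule set_eqI, rule iffI)
  fix p assume p: "p \<in> D_set g l n"
  then have "p \<in> perms (n + l)" "l \<le> tail_length p" by (auto simp: D_set_def stack_sortable_2)
  then obtain q where "q \<in> perms n" "p = q @ [n + 1..<n + l + 1]"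
    using tail_length_ge_iff_append by blast
  then show "p \<in> (\<lambda>q. q @ [n + 1..<n + l + 1]) ` body g n"
    using p sorted_stack_sort_stack_sort_append_tail[of q n l] leg_append_tail[of q n l]
    unfolding D_set_def stack_sortable_2 body_def by auto
next
  fix p assume "p \<in> (\<lambda>q. q @ [n + 1..<n + l + 1]) ` body g n"
  then obtain q where q: "q \<in> perms n" "sorted (stack_sort (stack_sort q))" "leg q = g"
      "p = q @ [n + 1..<n + l + 1]"
    unfolding body_def stack_sortable_2 by blast
  moreover from this have "l \<le> tail_length p"
    using tail_length_ge_iff_append append_tail_perms by blast
  ultimately show "p \<in> D_set g l n"
    using sorted_stack_sort_stack_sort_append_tail[of q n l] leg_append_tail[of q n l]
      append_tail_perms[of q n l]
    unfolding D_set_def stack_sortable_2 by simp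
qed

lemma E_poly_eq: "E_poly g l n = (\<Sum>q\<in>body g n. preimage_poly (q @ [n + 1..<n + l + 1]))"
proof -
  have "inj_on (\<lambda>q. q @ [n + 1..<n + l + 1]) (body g n)" by (auto simp: inj_on_def)
  then show ?thesis
    unfolding E_poly_def D_set_eq by (simp add: des_peak_poly_vimage_stack_sort sum.reindex)
qed

text \<open>The spaces 0 and \<open>n\<close> are always legal, and there are \<open>n + 1\<close>
  spaces in all.\<close>

lemma leg_bounds:
  assumes "q \<in> perms n" "0 < n"
  shows "2 \<le> leg q" "leg q \<le> n + 1"
proof -
  let ?S = "{x \<in> {0..n}. legal_space q x}"
  have leg: "leg q = card ?S" using length_perms[OF assms(1)] by (simp add: leg_def)
  have "\<forall>v\<in>set q. 0 < v" "\<forall>v\<in>set q. v \<le> n" using assms(1) unfolding perms_iff by auto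
  then have "{0, n} \<subseteq> ?S" by (auto intro: legal_space_above legal_space_below)
  from card_mono[OF _ this] show "2 \<le> leg q" unfolding leg using assms(2) by simp
  have "card ?S \<le> card {0..n}" by (intro card_mono) auto
  then show "leg q \<le> n + 1" unfolding leg by simp
qed

lemma body_empty: "0 < n \<Longrightarrow> g < 2 \<or> n + 1 < g \<Longrightarrow> body g n = {}"
  using leg_bounds by (force simp: body_def stack_sortable_2)

lemma body_1: "body g 1 = (if g = 2 then {[1]} else {})"
proof -
  have "perms 1 = {[1]}" by simp
  moreover have "stack_sort [1] = [1]" by (simp add: stack_sort_def)
  moreover have "leg [1] = 2" using leg_bounds[of "[1]" 1] by simp
  ultimately show ?thesis unfolding body_def stack_sortable_2 by auto
qed

section \<open>Joining two words around a new maximum\<close>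

text \<open>The map ranks \<open>S\<close> from the top: the largest element gets rank 1. It is
  applied to the set of legal spaces.\<close>

lemma bij_betw_card_ge:
  fixes S :: "nat set"
  assumes "finite S"
  shows "bij_betw (\<lambda>k. card {x \<in> S. k \<le> x}) S {1..card S}"
proof -
  let ?t = "\<lambda>k. card {x \<in> S. k \<le> x}"
  have less: "?t k' < ?t k" if "k \<in> S" "k < k'" for k k'
  proof (rule psubset_card_mono)
    have "{x \<in> S. k' \<le> x} \<subseteq> {x \<in> S. k \<le> x}" using that(2) by auto
    moreover have "k \<in> {x \<in> S. k \<le> x}" "k \<notin> {x \<in> S. k' \<le> x}" using that by auto
    ultimately show "{x \<in> S. k' \<le> x} \<subset> {x \<in> S. k \<le> x}" by blast
  qed (use assms in simp)
  have inj: "inj_on ?t S"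
  proof (rule inj_onI)
    fix k k' assume *: "k \<in> S" "k' \<in> S" "?t k = ?t k'"
    have "\<not> k < k'" using less[OF *(1), of k'] *(3) by linarith
    moreover have "\<not> k' < k" using less[OF *(2), of k] *(3) by linarith
    ultimately show "k = k'" by simp
  qed
  have "?t k \<in> {1..card S}" if "k \<in> S" for k
  proof -
    have "card {k} \<le> ?t k" using assms that by (intro card_mono) auto
    moreover have "?t k \<le> card S" using assms by (intro card_mono) auto
    ultimately show ?thesis by simp
  qed
  then have "?t ` S \<subseteq> {1..card S}" by blast
  moreover have "card (?t ` S) = card {1..card S}" using inj by (simp add: card_image)
  ultimately have "?t ` S = {1..card S}" by (intro card_subset_eq) auto
  then show ?thesis using inj by (simp add: bij_betw_def)
qed

lemma card_card_ge_eq: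
  fixes S :: "nat set"
  assumes "finite S"
  shows "card {k \<in> S. card {x \<in> S. k \<le> x} = r} = (if 1 \<le> r \<and> r \<le> card S then 1 else 0)"
proof -
  let ?t = "\<lambda>k. card {x \<in> S. k \<le> x}"
  have bij: "bij_betw ?t S {1..card S}" using assms by (rule bij_betw_card_ge)
  show ?thesis
  proof (cases "1 \<le> r \<and> r \<le> card S")
    case True
    then obtain k where k: "k \<in> S" "?t k = r"
      using bij by (metis (no_types, lifting) atLeastAtMost_iff bij_betw_def imageE)
    then have "{k \<in> S. ?t k = r} = {k}" using bij by (auto simp: bij_betw_def inj_on_def)
    then show ?thesis using True by simp
  next
    case False
    have "?t k \<in> {1..card S}" if "k \<in> S" for k using bij that by (rule bij_betwE[rule_format])
    then have "{k \<in> S. ?t k = r} = {}" using False by auto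
    then show ?thesis using False by (simp only: card.empty if_False)
  qed
qed

lemma downward_closed_eq_atLeastAtMost:
  fixes S :: "nat set"
  assumes "finite S" "0 \<notin> S" "\<And>x y. x \<in> S \<Longrightarrow> 0 < y \<Longrightarrow> y < x \<Longrightarrow> y \<in> S"
  shows "S = {1..card S}"
proof (cases "S = {}")
  case False
  have "S = {1..Max S}"
  proof (rule set_eqI, rule iffI)
    fix y assume "y \<in> S"
    then show "y \<in> {1..Max S}" using assms(1,2) by (cases y) auto
  next
    fix y assume y: "y \<in> {1..Max S}"
    show "y \<in> S"
    proof (cases "y = Max S")
      case True
      then show ?thesis using False assms(1) by (metis Max_in)
    next
      case neq: False
      then show ?thesis using assms(3)[of "Max S" y] y False assms(1) by simp
    qed
  qed
  then have "card S = Max S" by (metis card_atLeastAtMost diff_Suc_1)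
  then show ?thesis using \<open>S = {1..Max S}\<close> by simp
qed simp

text \<open>Standardization: the pattern is recovered by applying the inverse of \<open>h\<close>
  letterwise.\<close>

lemma ex_perms_map:
  assumes "distinct w" "set w = h ` {1..n}" "inj_on h {1..n}"
  shows "\<exists>q\<in>perms n. w = map h q"
proof
  let ?g = "inv_into {1..n} h"
  have inj: "inj_on ?g (set w)" using assms(2) by (simp add: inj_on_inv_into)
  have "?g ` set w = {1..n}" using assms(2,3) by (simp add: inv_into_image_cancel)
  then show "map ?g w \<in> perms n" using inj assms(1) unfolding perms_iff by (simp add: distinct_map)
  show "w = map h (map ?g w)"
  proof -
    have "(h \<circ> ?g) x = x" if "x \<in> set w" for x
      using that unfolding assms(2) by (simp only: o_apply f_inv_into_f)
    then have "map (h \<circ> ?g) w = w" by (rule map_idI)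
    then show ?thesis by simp
  qed
qed

text \<open>
  The patterns \<open>u\<close> and \<open>v\<close> are placed around a new maximum so that \<open>p\<close> letters of \<open>u\<close> are below \<open>v\<close>
  and the largest letter \<open>p + 1\<close> of \<open>u\<close> is inserted between the letters \<open>k\<close> and \<open>k + 1\<close> of \<open>v\<close>.
\<close>

definition low_map :: "nat \<Rightarrow> nat \<Rightarrow> nat \<Rightarrow> nat" where
  "low_map p k v = (if v \<le> p then v else v + k)"

definition high_map :: "nat \<Rightarrow> nat \<Rightarrow> nat \<Rightarrow> nat" where
  "high_map p k v = (if v \<le> k then v + p else v + p + 1)"

definition join :: "nat \<Rightarrow> nat \<Rightarrow> nat list \<Rightarrow> nat list \<Rightarrow> nat list" where
  "join p k u v = map (low_map p k) u @ (p + length v + 2) # map (high_map p k) v"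

lemma strict_mono_low_map: "strict_mono_on A (low_map p k)"
  by (rule strict_mono_onI) (auto simp: low_map_def)

lemma strict_mono_high_map: "strict_mono_on A (high_map p k)"
  by (rule strict_mono_onI) (auto simp: high_map_def)

lemma low_map_image: "low_map p k ` {1..p + 1} = {1..p} \<union> {p + 1 + k}"
proof -
  have "{1..p + 1} = {1..p} \<union> {p + 1}" by auto
  then have "low_map p k ` {1..p + 1} = low_map p k ` {1..p} \<union> {low_map p k (p + 1)}"
    by (simp only: image_Un image_insert image_empty)
  moreover have "low_map p k ` {1..p} = {1..p}"
    by (auto simp: low_map_def)
  ultimately show ?thesis by (simp add: low_map_def)
qed

lemma high_map_image:
  assumes "k \<le> i"
  shows "high_map p k ` {1..i} = {p + 1..p + i + 1} - {p + 1 + k}"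
proof (rule set_eqI, rule iffI)
  fix x assume "x \<in> high_map p k ` {1..i}"
  then show "x \<in> {p + 1..p + i + 1} - {p + 1 + k}" by (auto simp: high_map_def split: if_splits)
next
  fix x assume x: "x \<in> {p + 1..p + i + 1} - {p + 1 + k}"
  show "x \<in> high_map p k ` {1..i}"
  proof (cases "x \<le> p + k")
    case True
    then show ?thesis using x assms by (intro image_eqI[of _ _ "x - p"]) (auto simp: high_map_def)
  next
    case False
    then show ?thesis using x by (intro image_eqI[of _ _ "x - p - 1"]) (auto simp: high_map_def)
  qed
qed

lemma join_sets:
  assumes "u \<in> perms (p + 1)" "v \<in> perms i" "k \<le> i"
  shows "set (map (low_map p k) u) = {1..p} \<union> {p + 1 + k}"
    and "set (map (high_map p k) v) = {p + 1..p + i + 1} - {p + 1 + k}"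
    and "distinct (map (low_map p k) u)" "distinct (map (high_map p k) v)"
  using assms low_map_image high_map_image
    strict_mono_on_imp_inj_on[OF strict_mono_low_map] strict_mono_on_imp_inj_on[OF strict_mono_high_map]
  unfolding perms_iff by (simp_all only: set_map distinct_map)

lemma join_distinct_max:
  assumes "u \<in> perms (p + 1)" "v \<in> perms i" "k \<le> i"
  shows "distinct (map (low_map p k) u @ (p + i + 2) # map (high_map p k) v)"
    and "\<forall>x\<in>set (map (low_map p k) u) \<union> set (map (high_map p k) v). x < p + i + 2"
proof -
  note sets = join_sets[OF assms]
  show *: "\<forall>x\<in>set (map (low_map p k) u) \<union> set (map (high_map p k) v). x < p + i + 2"
    unfolding sets using assms(3) by auto
  have "set (map (low_map p k) u) \<inter> set (map (high_map p k) v) = {}"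
    unfolding sets by auto
  then show "distinct (map (low_map p k) u @ (p + i + 2) # map (high_map p k) v)"
    using sets(3,4) * by (auto simp del: set_map)
qed

lemma join_perms:
  assumes "u \<in> perms (p + 1)" "v \<in> perms i" "k \<le> i"
  shows "join p k u v \<in> perms (p + i + 2)"
proof -
  have "set (join p k u v) =
      ({1..p} \<union> {p + 1 + k}) \<union> ({p + i + 2} \<union> ({p + 1..p + i + 1} - {p + 1 + k}))"
    unfolding join_def length_perms[OF assms(2)] using join_sets(1,2)[OF assms] by auto
  also have "\<dots> = {1..p + i + 2}" using assms(3) by auto
  finally show ?thesis
    using join_distinct_max(1)[OF assms] length_perms[OF assms(2)]
    unfolding perms_iff join_def by simp
qed

text \<open>Above the gap \<open>p + 1 + k\<close> the letters of \<open>v\<close> are shifted by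
  \<open>p + 1\<close>, hence so are its spaces from \<open>k\<close> on.\<close>

lemma legal_space_high_map:
  assumes "k \<le> y"
  shows "legal_space (map (high_map p k) v) (p + 1 + y) \<longleftrightarrow> legal_space v y"
  by (rule legal_space_map[OF strict_mono_high_map]) (use assms in \<open>auto simp: high_map_def\<close>)

lemma legal_space_high_map_below:
  assumes "x \<le> p" "0 \<notin> set v"
  shows "legal_space (map (high_map p k) v) x"
proof (rule legal_space_below)
  have "x < high_map p k a" if "a \<in> set v" for a
    using assms that by (cases "a = 0") (auto simp: high_map_def)
  then show "\<forall>a\<in>set (map (high_map p k) v). x < a" by auto
qed

text \<open>All left letters except the largest are below the right block by construction, so of the
  conditions linking the two sides only one survives: the largest left letter must lie in a legal
  space of the right block.\<close>

lemma sorted_stack_sort_stack_sort_join: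
  assumes "u \<in> perms (p + 1)" "v \<in> perms i" "k \<le> i"
  shows "sorted (stack_sort (stack_sort (join p k u v))) \<longleftrightarrow>
    sorted (stack_sort (stack_sort u)) \<and> sorted (stack_sort (stack_sort v)) \<and> legal_space v k"
proof -
  let ?u = "map (low_map p k) u" and ?v = "map (high_map p k) v"
  note sets = join_sets[OF assms]
  have d: "distinct u" "distinct v" "0 \<notin> set v" using assms unfolding perms_iff by auto
  have "Max (set ?u) = p + 1 + k" unfolding sets by (rule Max_eqI) auto
  then have "\<forall>x\<in>set ?u. x < Max (set ?u) \<longrightarrow> (\<forall>a\<in>set ?v. x < a)"
    using sets(1,2) by (auto simp del: set_map)
  moreover have "(\<forall>x\<in>set ?u. legal_space ?v x) \<longleftrightarrow> legal_space v k"
    unfolding sets(1) using legal_space_high_map_below[OF _ d(3)] legal_space_high_map[of k k p v] by auto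
  ultimately show ?thesis
    unfolding join_def length_perms[OF assms(2)]
      sorted_stack_sort_stack_sort_max[OF join_distinct_max[OF assms]]
    using sorted_stack_sort_stack_sort_map[OF d(1) strict_mono_low_map]
      sorted_stack_sort_stack_sort_map[OF d(2) strict_mono_high_map] by blast
qed

text \<open>Up to \<open>p\<close> the spaces are those of \<open>u\<close>, then \<open>k\<close>
  illegal ones follow, and from \<open>p + 1 + k\<close> on they are the spaces of \<open>v\<close>
  from \<open>k\<close> on. The top space of the result balances the always legal top space of
  \<open>u\<close>.\<close>

lemma leg_join:
  assumes "u \<in> perms (p + 1)" "v \<in> perms i" "k \<le> i" "legal_space v k"
  shows "leg (join p k u v) = leg u + card {x \<in> {k..i}. legal_space v x}"
proof -
  let ?u = "map (low_map p k) u" and ?v = "map (high_map p k) v"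
  note sets = join_sets[OF assms(1-3)]
  have v: "0 \<notin> set v" "\<forall>x\<in>set v. x \<le> i" using assms unfolding perms_iff by auto
  have legal: "legal_space (join p k u v) x \<longleftrightarrow> legal_space ?u x \<and> legal_space ?v x \<and>
    \<not> (\<exists>c\<in>set ?u. \<exists>a\<in>set ?v. a \<le> x \<and> x < c)" for x
    unfolding join_def length_perms[OF assms(2)]
    by (rule legal_space_max[OF join_distinct_max(2)[OF assms(1-3)]])
  have low: "legal_space (join p k u v) x \<longleftrightarrow> legal_space u x" if "x \<le> p" for x
  proof -
    have "legal_space ?u x \<longleftrightarrow> legal_space u x"
      by (rule legal_space_map[OF strict_mono_low_map]) (use that in \<open>auto simp: low_map_def\<close>)
    then show ?thesis unfolding legal
      using legal_space_high_map_below[OF that v(1)] that sets(2) by (auto simp del: set_map)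
  qed
  \<comment> \<open>The letters \<open>p + 1 + k\<close>, the maximum and \<open>p + 1\<close> form
    a 231 pattern across these spaces.\<close>
  have mid: "\<not> legal_space (join p k u v) x" if "p < x" "x < p + 1 + k" for x
  proof -
    have "p + 1 \<in> set ?v" "p + 1 + k \<in> set ?u" "p + 1 \<le> x"
      unfolding sets using that by auto
    then show ?thesis unfolding legal using that(2) by blast
  qed
  have high: "legal_space (join p k u v) (p + 1 + y) \<longleftrightarrow> legal_space v y" if "k \<le> y" for y
  proof -
    have "\<forall>x\<in>set ?u. x \<le> p + 1 + y" unfolding sets using that by auto
    then show ?thesis
      unfolding legal using legal_space_high_map[OF that] legal_space_above by (meson not_le)
  qed
  have top: "legal_space u (p + 1)" "legal_space v (i + 1)"
    using assms(1) v(2) unfolding perms_iff by (auto intro!: legal_space_above)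
  let ?A = "{x \<in> {0..p}. legal_space u x}" and ?B = "{x \<in> {k..i}. legal_space v x}"
  have set_eq: "{x \<in> {0..p + i + 2}. legal_space (join p k u v) x} =
      ?A \<union> ((\<lambda>y. p + 1 + y) ` ?B \<union> {p + i + 2})" (is "?L = ?R")
  proof (rule set_eqI)
    fix x
    consider "x \<le> p" | "p < x" "x < p + 1 + k" | "p + 1 + k \<le> x" "x \<le> p + i + 1" | "x = p + i + 2"
      | "p + i + 2 < x" by linarith
    then show "x \<in> ?L \<longleftrightarrow> x \<in> ?R"
    proof cases
      case 1
      then show ?thesis using low by auto
    next
      case 2
      then show ?thesis using mid assms(3) by auto
    next
      case 3
      define y where "y = x - p - 1"
      have "x = p + 1 + y" "k \<le> y" "y \<le> i" using 3 by (auto simp: y_def)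
      then show ?thesis using high[of y] by auto
    next
      case 4
      then have "x = p + 1 + (i + 1)" by simp
      then show ?thesis using high[of "i + 1"] top(2) assms(3) 4 by simp
    next
      case 5
      then show ?thesis by auto
    qed
  qed
  have "length (join p k u v) = p + i + 2" using length_perms[OF join_perms[OF assms(1-3)]] .
  then have "leg (join p k u v) = card ?R"
    unfolding leg_def set_eq[symmetric] by simp
  also have "\<dots> = card ?A + (card ((\<lambda>y. p + 1 + y) ` ?B) + 1)"
    by (subst card_Un_disjoint, simp, simp, force) (subst card_Un_disjoint, auto)
  also have "card ((\<lambda>y. p + 1 + y) ` ?B) = card ?B"
    by (rule card_image) (simp add: inj_on_def)
  also have "card ?A + (card ?B + 1) = leg u + card ?B"
  proof -
    have "{x \<in> {0..p + 1}. legal_space u x} = insert (p + 1) ?A"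
      using top(1) by (auto simp: le_Suc_eq)
    then have "leg u = card ?A + 1"
      using length_perms[OF assms(1)] by (simp add: leg_def)
    then show ?thesis by simp
  qed
  finally show ?thesis .
qed

text \<open>Sortability puts the non-maximal letters of \<open>l\<close> below \<open>r\<close>, so
  they are an initial segment of the values. The maximum of \<open>l\<close> determines the gap
  \<open>k\<close>, and \<open>r\<close> takes the other values.\<close>

lemma ex_join:
  assumes "l @ (n + 1) # r \<in> perms (n + 1)" "l \<noteq> []" "r \<noteq> []"
    and "sorted (stack_sort (stack_sort (l @ (n + 1) # r)))"
  obtains p i k u v where "u \<in> perms (p + 1)" "v \<in> perms i" "k \<le> i" "0 < i" "n = p + 1 + i"
    "l @ (n + 1) # r = join p k u v"
proof -
  have dist: "distinct (l @ (n + 1) # r)" and set: "set (l @ (n + 1) # r) = {1..n + 1}"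
    using assms(1) unfolding perms_iff by blast+
  have lr: "set l \<union> set r = {1..n}"
  proof -
    have "set l \<union> set r = set (l @ (n + 1) # r) - {n + 1}" using dist by auto
    also have "\<dots> = {1..n + 1} - {n + 1}" by (simp only: set)
    also have "\<dots> = {1..n}" by auto
    finally show ?thesis .
  qed
  then have max: "\<forall>x\<in>set l \<union> set r. x < n + 1" by simp
  define M where "M = Max (set l)"
  have M: "M \<in> set l" "\<And>x. x \<in> set l \<Longrightarrow> x \<le> M" using assms(2) by (auto simp: M_def)
  have below: "x < a" if "x \<in> set l" "x \<noteq> M" "a \<in> set r" for x a
  proof -
    have "x < Max (set l)" using le_neq_implies_less[OF M(2)[OF that(1)] that(2)] by (simp add: M_def)
    then show ?thesis
      using assms(4) that(1,3) unfolding sorted_stack_sort_stack_sort_max[OF dist max] by blast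
  qed
  define p where "p = length l - 1"
  define i where "i = length r"
  have cl: "card (set l) = p + 1" using dist assms(2) by (simp add: p_def distinct_card)
  have "card (set l - {M}) = p" using M(1) cl by simp
  \<comment> \<open>A smaller value inside \<open>r\<close> would contradict \<open>below\<close>,
    so it belongs to \<open>l\<close>, and it is not \<open>M\<close>.\<close>
  moreover have "set l - {M} = {1..card (set l - {M})}"
  proof (rule downward_closed_eq_atLeastAtMost)
    have "0 \<notin> {1..n}" by simp
    then show "0 \<notin> set l - {M}" using lr by blast
    fix x y assume xy: "x \<in> set l - {M}" "0 < y" "y < x"
    have "x \<in> {1..n}" using xy lr by blast
    then have "y \<in> {1..n}" using xy by auto
    then have "y \<in> set l \<union> set r" using lr by blast
    then show "y \<in> set l - {M}" using xy below[of x y] M(2)[of x] by auto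
  qed simp
  ultimately have l0: "set l - {M} = {1..p}" by simp
  have n: "n = p + 1 + i"
  proof -
    have "p + 1 + i = length (l @ (n + 1) # r) - 1" using assms(2) by (cases l) (simp_all add: p_def i_def)
    then show ?thesis using length_perms[OF assms(1)] by simp
  qed
  have "M \<in> {1..n}" using M(1) lr by blast
  moreover have "M \<notin> {1..p}" using l0 by blast
  ultimately have Mb: "p + 1 \<le> M" "M \<le> n" by auto
  define k where "k = M - p - 1"
  have k: "M = p + 1 + k" "k \<le> i" using Mb n by (auto simp: k_def)
  have "set l = low_map p k ` {1..p + 1}" unfolding low_map_image using l0 M(1) k(1) by blast
  moreover have "set r = high_map p k ` {1..i}"
  proof -
    have "set r = {1..n} - set l" using lr dist by auto
    also have "\<dots> = {1..n} - ({1..p} \<union> {p + 1 + k})" using l0 M(1) k(1) by blast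
    also have "\<dots> = {p + 1..p + i + 1} - {p + 1 + k}" unfolding n by auto
    finally show ?thesis using high_map_image[OF k(2)] by simp
  qed
  ultimately obtain u v where uv: "u \<in> perms (p + 1)" "l = map (low_map p k) u"
    "v \<in> perms i" "r = map (high_map p k) v"
    using ex_perms_map[of l "low_map p k" "p + 1"] ex_perms_map[of r "high_map p k" i] dist
      strict_mono_on_imp_inj_on[OF strict_mono_low_map] strict_mono_on_imp_inj_on[OF strict_mono_high_map]
    by (metis distinct.simps(2) distinct_append)
  have "0 < i" using assms(3) by (simp add: i_def)
  moreover have "l @ (n + 1) # r = join p k u v"
    using uv n by (simp add: join_def i_def)
  ultimately show ?thesis using that uv(1,3) k(2) n by blast
qed

text \<open>The position of the maximum gives \<open>p\<close>, the largest letter before it gives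
  \<open>k\<close>, and the relabellings are injective.\<close>

lemma join_inject:
  assumes "u \<in> perms (p + 1)" "v \<in> perms i" "k \<le> i"
    and "u' \<in> perms (p' + 1)" "v' \<in> perms i'" "k' \<le> i'"
    and "p + i = p' + i'" "join p k u v = join p' k' u' v'"
  shows "p = p' \<and> i = i' \<and> k = k' \<and> u = u' \<and> v = v'"
proof -
  have notin: "p + i + 2 \<notin> set (map (low_map p k) u)" "p + i + 2 \<notin> set (map (high_map p k) v)"
    using join_distinct_max(2)[OF assms(1-3)] by blast+
  have "map (low_map p k) u @ (p + i + 2) # map (high_map p k) v =
      map (low_map p' k') u' @ (p + i + 2) # map (high_map p' k') v'"
    using assms(7,8) length_perms[OF assms(2)] length_perms[OF assms(5)] by (simp add: join_def)
  then have eq: "map (low_map p k) u = map (low_map p' k') u'"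
      "map (high_map p k) v = map (high_map p' k') v'"
    unfolding append_Cons_eq_iff[OF notin] by blast+
  then have "length u = length u'" by (metis length_map)
  then have p: "p = p'" using length_perms[OF assms(1)] length_perms[OF assms(4)] by simp
  have Max: "Max ({1..p} \<union> {p + 1 + k}) = p + 1 + k" for k by (rule Max_eqI) auto
  have "{1..p} \<union> {p + 1 + k} = {1..p} \<union> {p + 1 + k'}"
    using join_sets(1)[OF assms(1-3)] join_sets(1)[OF assms(4-6)] eq(1) p by metis
  then have k: "k = k'" using Max[of k] Max[of k'] by simp
  have "inj (low_map p' k')" "inj (high_map p' k')"
    by (rule strict_mono_on_imp_inj_on[OF strict_mono_low_map],
        rule strict_mono_on_imp_inj_on[OF strict_mono_high_map])
  then have "u = u'" "v = v'" using eq unfolding p k by (simp_all only: inj_map_eq_map)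
  then show ?thesis using p k assms(7) by simp
qed

section \<open>The recursion\<close>

text \<open>Restores the standard form used in \<open>E_poly_eq\<close> after relabelling and after
  cutting the tail.\<close>

lemma preimage_poly_append_upt:
  assumes "u \<in> perms k" "strict_mono_on (set u) h" "sorted_wrt (<) t" "length t = l"
    and "\<And>x y. x \<in> set u \<Longrightarrow> y \<in> set t \<Longrightarrow> h x < y"
  shows "preimage_poly (map h u @ t) = preimage_poly (u @ [k + 1..<k + l + 1])"
proof (rule preimage_poly_append_tail[OF _ assms(2)])
  show "x < y" if "x \<in> set u" "y \<in> set [k + 1..<k + l + 1]" for x y
    using that assms(1) unfolding perms_iff by auto
  show "distinct u" using assms(1) unfolding perms_iff by blast
  show "sorted_wrt (<) [k + 1..<k + l + 1]" by (rule sorted_wrt_upt)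
  show "length [k + 1..<k + l + 1] = length t" using assms(4) by (simp del: upt_Suc)
qed (use assms in blast)+

section \<open>The maximum in last or in first position\<close>

lemma upt_snoc_perms: "q \<in> perms n \<Longrightarrow> q @ [n + 1] \<in> perms (n + 1)"
  using append_tail_perms[of q n 1] by simp

lemma body_last:
  assumes "0 < g"
  shows "{q \<in> body g (n + 1). \<exists>l. q = l @ [n + 1]} = (\<lambda>q. q @ [n + 1]) ` body (g - 1) n"
proof -
  have iff: "q @ [n + 1] \<in> body g (n + 1) \<longleftrightarrow> q \<in> body (g - 1) n" if "q \<in> perms n" for q
  proof -
    have upt: "[n + 1..<n + 1 + 1] = [n + 1]" by simp
    have "leg q + 1 = g \<longleftrightarrow> leg q = g - 1" using assms by auto
    then show ?thesis
      using that upt_snoc_perms[OF that] leg_append_tail[OF that, of 1]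
        sorted_stack_sort_stack_sort_append_tail[OF that, of 1]
      unfolding upt body_def stack_sortable_2 mem_Collect_eq by (simp only: simp_thms)
  qed
  have "q \<in> perms n" if "q @ [n + 1] \<in> perms (n + 1)" for q
  proof -
    have "distinct (q @ [n + 1])" "set (q @ [n + 1]) = {1..n + 1}"
      using that unfolding perms_iff by blast+
    moreover from this have "set q = {1..n + 1} - {n + 1}" by auto
    moreover have "{1..n + 1} - {n + 1} = {1..n}" by auto
    ultimately show ?thesis unfolding perms_iff by simp
  qed
  moreover have "body g n \<subseteq> perms n" for g n unfolding body_def stack_sortable_2 by blast
  ultimately show ?thesis using iff by blast
qed

text \<open>A final maximum joins the tail, which then has \<open>l + 1\<close> letters, and takes
  one legal space with it.\<close>

lemma sum_body_last:
  assumes "0 < g"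
  shows "(\<Sum>q | q \<in> body g (n + 1) \<and> (\<exists>l. q = l @ [n + 1]).
    preimage_poly (q @ [n + 1 + 1..<n + 1 + l + 1])) = E_poly (g - 1) (l + 1) n"
proof -
  have "inj_on (\<lambda>q. q @ [n + 1]) (body (g - 1) n)" by (auto simp: inj_on_def)
  moreover have "[n + 1] @ [n + 1 + 1..<n + 1 + l + 1] = [n + 1..<n + (l + 1) + 1]"
    by (simp add: upt_conv_Cons del: upt_Suc)
  ultimately show ?thesis
    unfolding body_last[OF assms] E_poly_eq by (simp add: sum.reindex del: upt_Suc)
qed

text \<open>A leading maximum takes part in no 231 pattern, so it only contributes the new top
  space.\<close>

lemma body_first:
  assumes "0 < g" "0 < n"
  shows "{q \<in> body g (n + 1). \<exists>r. q = (n + 1) # r} = (#) (n + 1) ` body (g - 1) n"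
proof -
  have iff: "(n + 1) # r \<in> body g (n + 1) \<longleftrightarrow> r \<in> body (g - 1) n" if r: "r \<in> perms n" for r
  proof -
    have d: "distinct ([] @ (n + 1) # r)" "\<forall>x\<in>set [] \<union> set r. x < n + 1"
      using r unfolding perms_iff by auto
    have "sorted (stack_sort (stack_sort ((n + 1) # r))) \<longleftrightarrow> sorted (stack_sort (stack_sort r))"
      using sorted_stack_sort_stack_sort_max[OF d] by simp
    moreover have "(n + 1) # r \<in> perms (n + 1)"
    proof -
      have "distinct ((n + 1) # r)" "set r = {1..n}" using d(1) r unfolding perms_iff by simp_all
      moreover have "insert (n + 1) {1..n} = {1..n + 1}" by auto
      ultimately show ?thesis unfolding perms_iff by (simp only: list.set simp_thms)
    qed
    moreover have "leg ((n + 1) # r) = leg r + 1"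
    proof -
      have legal: "legal_space ((n + 1) # r) x \<longleftrightarrow> legal_space r x" for x
        using legal_space_max[OF d(2), of x] legal_space_above[of "[]" x] by simp
      have "\<forall>x\<in>set r. x \<le> n + 1" using d(2) by (auto intro: less_imp_le)
      then have "legal_space r (n + 1)" by (rule legal_space_above)
      then have "{x \<in> {0..n + 1}. legal_space r x} = insert (n + 1) {x \<in> {0..n}. legal_space r x}"
        by (auto simp: le_Suc_eq)
      then show ?thesis using length_perms[OF r] by (simp add: leg_def legal[simplified])
    qed
    moreover have "leg r + 1 = g \<longleftrightarrow> leg r = g - 1" using assms(1) by auto
    ultimately show ?thesis
      using r unfolding body_def stack_sortable_2 mem_Collect_eq by (simp only: simp_thms)
  qed
  have "r \<in> perms n" if "(n + 1) # r \<in> perms (n + 1)" for r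
  proof -
    have "distinct ((n + 1) # r)" "set ((n + 1) # r) = {1..n + 1}"
      using that unfolding perms_iff by blast+
    moreover from this have "set r = {1..n + 1} - {n + 1}" by auto
    moreover have "{1..n + 1} - {n + 1} = {1..n}" by auto
    ultimately show ?thesis unfolding perms_iff by simp
  qed
  moreover have "body g n \<subseteq> perms n" for g n unfolding body_def stack_sortable_2 by blast
  ultimately show ?thesis using iff by blast
qed

text \<open>With nothing to the left of the maximum, the outer factor of each hook is an increasing
  word and yields an \<open>L_poly\<close>.\<close>

lemma sum_body_first:
  assumes "0 < g" "0 < n"
  shows "(\<Sum>q | q \<in> body g (n + 1) \<and> (\<exists>r. q = (n + 1) # r).
    preimage_poly (q @ [n + 1 + 1..<n + 1 + l + 1])) =
    (\<Sum>j = 1..l. E_poly (g - 1) (j - 1) n * L_poly (l - j + 1))"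
proof -
  let ?T = "[n + 1 + 1..<n + 1 + l + 1]"
  have hooks: "preimage_poly ((n + 1) # r @ ?T) =
      (\<Sum>j = 1..l. preimage_poly (r @ [n + 1..<n + (j - 1) + 1]) * L_poly (l - j + 1))"
    if r: "r \<in> body (g - 1) n" for r
  proof -
    have rp: "r \<in> perms n" using r unfolding body_def stack_sortable_2 by blast
    have rd: "distinct r" "set r = {1..n}" using rp unfolding perms_iff by blast+
    have "preimage_poly ([] @ (n + 1) # r @ ?T) =
      (\<Sum>j<length ?T. preimage_poly ([] @ (n + 1) # drop (Suc j) ?T) * preimage_poly (r @ take j ?T))"
    proof (rule preimage_poly_hooks)
      show "distinct ([] @ (n + 1) # r @ ?T)" using rd by (simp del: upt_Suc) auto
      show "\<forall>x\<in>set [] \<union> set r. x < n + 1" using rd by auto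
      show "r \<noteq> []" using length_perms[OF rp] assms(2) by auto
      show "sorted_wrt (<) ((n + 1) # ?T)" by (simp del: upt_Suc)
    qed
    also have "\<dots> = (\<Sum>j<l. preimage_poly (r @ [n + 1..<n + j + 1]) * L_poly (l - j))"
    proof (rule sum.cong)
      fix j assume j: "j \<in> {..<l}"
      have "preimage_poly ((n + 1) # drop (Suc j) ?T) = L_poly (length ((n + 1) # drop (Suc j) ?T))"
        by (rule preimage_poly_increasing) (simp_all del: upt_Suc)
      moreover have "length ((n + 1) # drop (Suc j) ?T) = l - j" using j by (simp del: upt_Suc)
      moreover have "preimage_poly (map id r @ take j ?T) = preimage_poly (r @ [n + 1..<n + j + 1])"
        by (rule preimage_poly_append_upt[OF rp])
          (use j rd in \<open>auto simp del: upt_Suc simp: take_upt strict_mono_on_def\<close>)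
      ultimately show "preimage_poly ([] @ (n + 1) # drop (Suc j) ?T) * preimage_poly (r @ take j ?T) =
        preimage_poly (r @ [n + 1..<n + j + 1]) * L_poly (l - j)"
        by (simp add: mult.commute del: upt_Suc)
    qed (simp del: upt_Suc)
    also have "\<dots> = (\<Sum>j = 1..l. preimage_poly (r @ [n + 1..<n + (j - 1) + 1]) * L_poly (l - j + 1))"
      by (rule sum.reindex_bij_witness[of _ "\<lambda>j. j - 1" Suc]) (auto simp del: upt_Suc simp: Suc_diff_Suc)
    finally show ?thesis by simp
  qed
  have "(\<Sum>q | q \<in> body g (n + 1) \<and> (\<exists>r. q = (n + 1) # r). preimage_poly (q @ ?T)) =
      (\<Sum>r\<in>body (g - 1) n. preimage_poly ((n + 1) # r @ ?T))"
    unfolding body_first[OF assms] by (subst sum.reindex) (auto simp: inj_on_def simp del: upt_Suc)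
  also have "\<dots> = (\<Sum>r\<in>body (g - 1) n. \<Sum>j = 1..l.
      preimage_poly (r @ [n + 1..<n + (j - 1) + 1]) * L_poly (l - j + 1))"
    using hooks by (rule sum.cong[OF refl])
  also have "\<dots> = (\<Sum>j = 1..l. \<Sum>r\<in>body (g - 1) n.
      preimage_poly (r @ [n + 1..<n + (j - 1) + 1]) * L_poly (l - j + 1))"
    by (rule sum.swap)
  finally show ?thesis unfolding E_poly_eq sum_distrib_right .
qed

text \<open>For the hook to the \<open>j\<close>-th tail letter, \<open>v\<close> keeps the
  \<open>j - 1\<close> letters before it. The tail of \<open>u\<close> is the maximum together with
  the \<open>l - j\<close> letters after the hook. The value does not depend on
  \<open>k\<close>.\<close>

lemma preimage_poly_join:
  assumes "u \<in> perms (p + 1)" "v \<in> perms i" "k \<le> i" "0 < i"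
  shows "preimage_poly (join p k u v @ [p + i + 2 + 1..<p + i + 2 + l + 1]) =
    (\<Sum>j = 1..l. preimage_poly (v @ [i + 1..<i + (j - 1) + 1]) *
      preimage_poly (u @ [p + 1 + 1..<p + 1 + (l - j + 1) + 1]))"
proof -
  let ?T = "[p + i + 2 + 1..<p + i + 2 + l + 1]"
  let ?u = "map (low_map p k) u" and ?v = "map (high_map p k) v" and ?m = "p + i + 2"
  note d = join_distinct_max[OF assms(1-3)]
  have "preimage_poly (?u @ ?m # ?v @ ?T) =
    (\<Sum>j<length ?T. preimage_poly (?u @ ?m # drop (Suc j) ?T) * preimage_poly (?v @ take j ?T))"
  proof (rule preimage_poly_hooks)
    have "set (?u @ ?m # ?v) \<inter> set ?T = {}"
    proof (rule Int_emptyI)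
      fix x assume "x \<in> set (?u @ ?m # ?v)" "x \<in> set ?T"
      then have "x = ?m \<or> x \<in> set ?u \<union> set ?v" "?m < x"
        by (simp_all del: upt_Suc set_map)
      then show False using d(2) by (metis less_asym less_irrefl)
    qed
    then show "distinct (?u @ ?m # ?v @ ?T)" using d(1) by (auto simp del: upt_Suc)
    show "?v \<noteq> []" using length_perms[OF assms(2)] assms(4) by auto
    show "sorted_wrt (<) (?m # ?T)" by (simp del: upt_Suc)
  qed fact
  also have "\<dots> = (\<Sum>j<l. preimage_poly (v @ [i + 1..<i + j + 1]) *
      preimage_poly (u @ [p + 1 + 1..<p + 1 + (l - j) + 1]))"
  proof (rule sum.cong)
    fix j assume j: "j \<in> {..<l}"
    have "preimage_poly (?u @ ?m # drop (Suc j) ?T) =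
        preimage_poly (u @ [p + 1 + 1..<p + 1 + (l - j) + 1])"
    proof (rule preimage_poly_append_upt[OF assms(1) strict_mono_low_map])
      show "low_map p k x < y" if "x \<in> set u" "y \<in> set (?m # drop (Suc j) ?T)" for x y
      proof -
        have "low_map p k x < ?m" using d(2) that(1) by simp
        moreover have "?m \<le> y" using that(2) by (auto simp del: upt_Suc)
        ultimately show ?thesis by simp
      qed
    qed (use j in \<open>simp_all del: upt_Suc\<close>)
    moreover have "preimage_poly (?v @ take j ?T) = preimage_poly (v @ [i + 1..<i + j + 1])"
    proof (rule preimage_poly_append_upt[OF assms(2) strict_mono_high_map])
      show "high_map p k x < y" if "x \<in> set v" "y \<in> set (take j ?T)" for x y
      proof -
        have "high_map p k x < ?m" using d(2) that(1) by simp
        moreover have "?m \<le> y" using in_set_takeD[OF that(2)] by (simp del: upt_Suc)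
        ultimately show ?thesis by simp
      qed
    qed (use j in \<open>simp_all del: upt_Suc add: sorted_wrt_take\<close>)
    ultimately show "preimage_poly (?u @ ?m # drop (Suc j) ?T) * preimage_poly (?v @ take j ?T) =
      preimage_poly (v @ [i + 1..<i + j + 1]) * preimage_poly (u @ [p + 1 + 1..<p + 1 + (l - j) + 1])"
      by (simp only: mult.commute)
  qed (simp del: upt_Suc)
  also have "\<dots> = (\<Sum>j = 1..l. preimage_poly (v @ [i + 1..<i + (j - 1) + 1]) *
      preimage_poly (u @ [p + 1 + 1..<p + 1 + (l - j + 1) + 1]))"
    by (rule sum.reindex_bij_witness[of _ "\<lambda>j. j - 1" Suc]) (auto simp del: upt_Suc simp: Suc_diff_Suc)
  finally show ?thesis unfolding join_def length_perms[OF assms(2)] append_assoc append_Cons .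
qed

text \<open>By \<open>ex_join\<close> and \<open>join_inject\<close>, \<open>join\<close> is a
  bijection from the quadruples of sizes, patterns and insertion spaces.\<close>

lemma sum_body_middle:
  fixes f :: "nat list \<Rightarrow> 'a::comm_monoid_add"
  shows "(\<Sum>q | q \<in> body g (n + 1) \<and> (\<exists>l r. q = l @ (n + 1) # r \<and> l \<noteq> [] \<and> r \<noteq> []). f q) =
    (\<Sum>i\<in>{1..<n}. \<Sum>v\<in>stack_sortable 2 i. \<Sum>u\<in>stack_sortable 2 (n - i).
      \<Sum>k | k \<le> i \<and> legal_space v k \<and> leg u + card {x \<in> {k..i}. legal_space v x} = g.
        f (join (n - i - 1) k u v))"
proof -
  define K where "K i v u =
    {k. k \<le> i \<and> legal_space v k \<and> leg u + card {x \<in> {k..i}. legal_space v x} = g}" for i v u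
  define I where "I = (SIGMA i:{1..<n}. SIGMA v:stack_sortable 2 i. SIGMA u:stack_sortable 2 (n - i). K i v u)"
  have finK: "finite (K i v u)" for i v u
    by (rule finite_subset[of _ "{..i}"]) (auto simp: K_def)
  let ?J = "\<lambda>(i, v, u, k). join (n - i - 1) k u v"
  have I: "u \<in> perms (n - i - 1 + 1)" "v \<in> perms i" "k \<le> i" "0 < i" "n - i - 1 + i + 2 = n + 1"
    "i < n"
    if "(i, v, u, k) \<in> I" for i v u k
  proof -
    have *: "u \<in> perms (n - i)" "i < n" "1 \<le> i"
      using that by (auto simp: I_def K_def stack_sortable_2)
    from *(2) have "n - i - 1 + 1 = n - i" by simp
    then show "u \<in> perms (n - i - 1 + 1)" using *(1) by (simp only:)
    show "v \<in> perms i" "k \<le> i" using that by (auto simp: I_def K_def stack_sortable_2)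
    show "0 < i" "n - i - 1 + i + 2 = n + 1" "i < n" using *(2,3) by auto
  qed
  have inj: "inj_on ?J I"
  proof (rule inj_onI)
    fix x y assume xy: "x \<in> I" "y \<in> I" "?J x = ?J y"
    obtain i v u k where x: "x = (i, v, u, k)" by (cases x)
    obtain i' v' u' k' where y: "y = (i', v', u', k')" by (cases y)
    have *: "(i, v, u, k) \<in> I" "(i', v', u', k') \<in> I"
      "join (n - i - 1) k u v = join (n - i' - 1) k' u' v'"
      using xy unfolding x y by simp_all
    have "n - i - 1 + i = n - i' - 1 + i'" using I(5)[OF *(1)] I(5)[OF *(2)] by simp
    from join_inject[OF I(1-3)[OF *(1)] I(1-3)[OF *(2)] this *(3)]
    show "x = y" unfolding x y by blast
  qed
  have img: "?J ` I = {q \<in> body g (n + 1). \<exists>l r. q = l @ (n + 1) # r \<and> l \<noteq> [] \<and> r \<noteq> []}"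
  proof (rule set_eqI, rule iffI)
    fix q assume "q \<in> ?J ` I"
    then obtain i v u k where *: "(i, v, u, k) \<in> I" "q = join (n - i - 1) k u v" by auto
    note I = I[OF *(1)]
    have ss: "sorted (stack_sort (stack_sort u))" "sorted (stack_sort (stack_sort v))" "legal_space v k"
      "leg u + card {x \<in> {k..i}. legal_space v x} = g"
      using *(1) by (auto simp: I_def K_def stack_sortable_2)
    have "q \<in> perms (n + 1)" using join_perms[OF I(1-3)] unfolding I(5) *(2) .
    moreover have "sorted (stack_sort (stack_sort q))"
      unfolding *(2) sorted_stack_sort_stack_sort_join[OF I(1-3)] using ss by blast
    moreover have "leg q = g" unfolding *(2) leg_join[OF I(1-3) ss(3)] by (rule ss(4))
    moreover have "\<exists>l r. q = l @ (n + 1) # r \<and> l \<noteq> [] \<and> r \<noteq> []"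
    proof (intro exI conjI)
      show "q = map (low_map (n - i - 1) k) u @ (n + 1) # map (high_map (n - i - 1) k) v"
        using *(2) I(5) length_perms[OF I(2)] by (simp add: join_def)
      show "map (low_map (n - i - 1) k) u \<noteq> []" "map (high_map (n - i - 1) k) v \<noteq> []"
        using length_perms[OF I(1)] length_perms[OF I(2)] I(4) by auto
    qed
    ultimately show "q \<in> {q \<in> body g (n + 1). \<exists>l r. q = l @ (n + 1) # r \<and> l \<noteq> [] \<and> r \<noteq> []}"
      unfolding body_def stack_sortable_2 by blast
  next
    fix q assume "q \<in> {q \<in> body g (n + 1). \<exists>l r. q = l @ (n + 1) # r \<and> l \<noteq> [] \<and> r \<noteq> []}"
    then obtain l r where q: "q \<in> body g (n + 1)" "q = l @ (n + 1) # r" "l \<noteq> []" "r \<noteq> []" by blast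
    then have qb: "l @ (n + 1) # r \<in> perms (n + 1)" "sorted (stack_sort (stack_sort (l @ (n + 1) # r)))"
      "leg (l @ (n + 1) # r) = g"
      unfolding body_def stack_sortable_2 by blast+
    from qb(1) q(3,4) qb(2) obtain p i k u v where *: "u \<in> perms (p + 1)" "v \<in> perms i" "k \<le> i"
      "0 < i" "n = p + 1 + i" "l @ (n + 1) # r = join p k u v"
      by (rule ex_join)
    have ss: "sorted (stack_sort (stack_sort u)) \<and> sorted (stack_sort (stack_sort v)) \<and> legal_space v k"
      using qb(2) unfolding *(6) sorted_stack_sort_stack_sort_join[OF *(1-3)] .
    then have "leg u + card {x \<in> {k..i}. legal_space v x} = g"
      using qb(3) leg_join[OF *(1-3)] unfolding *(6) by simp
    moreover have "n - i = p + 1" "i \<in> {1..<n}" using *(4,5) by auto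
    ultimately have "(i, v, u, k) \<in> I"
      using ss *(1-3) by (simp add: I_def K_def stack_sortable_2)
    moreover have "q = ?J (i, v, u, k)" using q(2) *(5,6) by simp
    ultimately show "q \<in> ?J ` I" by (rule rev_image_eqI)
  qed
  have "(\<Sum>q | q \<in> body g (n + 1) \<and> (\<exists>l r. q = l @ (n + 1) # r \<and> l \<noteq> [] \<and> r \<noteq> []). f q) =
      (\<Sum>(i, v, u, k)\<in>I. f (join (n - i - 1) k u v))"
    unfolding img[symmetric] sum.reindex[OF inj] by (simp add: o_def split_def)
  also have "\<dots> = (\<Sum>i\<in>{1..<n}. \<Sum>v\<in>stack_sortable 2 i. \<Sum>u\<in>stack_sortable 2 (n - i). \<Sum>k\<in>K i v u.
      f (join (n - i - 1) k u v))"
    unfolding I_def by (simp add: sum.Sigma finK finite_SigmaI)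
  finally show ?thesis by (simp only: K_def)
qed

text \<open>Grouping by \<open>a = leg v\<close> and \<open>b = leg u\<close> turns the condition
  into bounds on \<open>b\<close>; the remaining bounds are those of
  \<open>leg_bounds\<close>.\<close>

lemma sum_stack_sortable_leg:
  fixes f :: "nat list \<Rightarrow> 'a::comm_semiring_1" and h :: "nat list \<Rightarrow> 'a"
  assumes "1 \<le> i" "i < n"
  shows "(\<Sum>v\<in>stack_sortable 2 i. \<Sum>u\<in>stack_sortable 2 (n - i).
      if leg u < g \<and> g \<le> leg u + leg v then f v * h u else 0) =
    (\<Sum>a = 2..n. \<Sum>b = max 2 (g - a)..g - 1. (\<Sum>v\<in>body a i. f v) * (\<Sum>u\<in>body b (n - i). h u))"
proof -
  let ?S = "stack_sortable 2"
  have bounds: "leg v \<in> {2..m + 1}" if "v \<in> ?S m" "0 < m" for v m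
    using that leg_bounds[of v m] by (auto simp: stack_sortable_2)
  have inner: "(\<Sum>u\<in>?S (n - i). if leg u < g \<and> g \<le> leg u + a then h u else 0) =
      (\<Sum>b = max 2 (g - a)..g - 1. \<Sum>u\<in>body b (n - i). h u)" for a
  proof -
    let ?U = "{u \<in> ?S (n - i). leg u < g \<and> g \<le> leg u + a}"
    have "(\<Sum>u\<in>?S (n - i). if leg u < g \<and> g \<le> leg u + a then h u else 0) = (\<Sum>u\<in>?U. h u)"
      by (simp add: sum.inter_filter)
    also have "\<dots> = (\<Sum>b = max 2 (g - a)..g - 1. \<Sum>u\<in>{u \<in> ?U. leg u = b}. h u)"
    proof (rule sum.group[symmetric])
      show "leg ` ?U \<subseteq> {max 2 (g - a)..g - 1}"
      proof (intro image_subsetI)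
        fix u assume u: "u \<in> ?U"
        then have "2 \<le> leg u" using bounds[of u "n - i"] assms by simp
        then show "leg u \<in> {max 2 (g - a)..g - 1}" using u by auto
      qed
    qed auto
    also have "\<dots> = (\<Sum>b = max 2 (g - a)..g - 1. \<Sum>u\<in>body b (n - i). h u)"
      by (intro sum.cong refl) (auto simp: body_def)
    finally show ?thesis .
  qed
  have "(\<Sum>v\<in>?S i. \<Sum>u\<in>?S (n - i). if leg u < g \<and> g \<le> leg u + leg v then f v * h u else 0) =
      (\<Sum>v\<in>?S i. f v * (\<Sum>u\<in>?S (n - i). if leg u < g \<and> g \<le> leg u + leg v then h u else 0))"
    by (intro sum.cong refl) (auto simp: sum_distrib_left intro!: sum.cong)
  also have "\<dots> = (\<Sum>v\<in>?S i. f v * (\<Sum>b = max 2 (g - leg v)..g - 1. \<Sum>u\<in>body b (n - i). h u))"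
    by (simp only: inner)
  also have "\<dots> = (\<Sum>a = 2..n. \<Sum>v\<in>{v \<in> ?S i. leg v = a}.
      f v * (\<Sum>b = max 2 (g - leg v)..g - 1. \<Sum>u\<in>body b (n - i). h u))"
  proof (rule sum.group[symmetric])
    show "leg ` ?S i \<subseteq> {2..n}" using bounds[of _ i] assms by force
  qed auto
  also have "\<dots> = (\<Sum>a = 2..n. \<Sum>v\<in>body a i.
      f v * (\<Sum>b = max 2 (g - a)..g - 1. \<Sum>u\<in>body b (n - i). h u))"
    by (intro sum.cong refl) (auto simp: body_def)
  also have "\<dots> = (\<Sum>a = 2..n. \<Sum>b = max 2 (g - a)..g - 1.
      (\<Sum>v\<in>body a i. f v) * (\<Sum>u\<in>body b (n - i). h u))"
    by (simp only: sum_distrib_right[symmetric] sum_distrib_left[symmetric])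
  finally show ?thesis .
qed

text \<open>The inner cardinality is the rank of \<open>k\<close> from the top, and each rank from 1
  to \<open>leg v\<close> is attained once.\<close>

lemma card_legal_spaces:
  assumes "v \<in> perms i"
  shows "card {k. k \<le> i \<and> legal_space v k \<and> c + card {x \<in> {k..i}. legal_space v x} = g} =
    (if c < g \<and> g \<le> c + leg v then 1 else 0)"
proof -
  let ?S = "{x \<in> {0..i}. legal_space v x}"
  have *: "card {x \<in> {k..i}. legal_space v x} = card {x \<in> ?S. k \<le> x}" for k
    by (rule arg_cong[where f = card]) auto
  have leg: "leg v = card ?S" using length_perms[OF assms] by (simp add: leg_def)
  show ?thesis
  proof (cases "c \<le> g")
    case True
    then have "{k. k \<le> i \<and> legal_space v k \<and> c + card {x \<in> {k..i}. legal_space v x} = g} =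
        {k \<in> ?S. card {x \<in> ?S. k \<le> x} = g - c}"
    proof -
      have "c + m = g \<longleftrightarrow> m = g - c" for m using True by auto
      then show ?thesis
        unfolding * by (simp only: mem_Collect_eq atLeastAtMost_iff le0 simp_thms conj_assoc)
    qed
    then show ?thesis using card_card_ge_eq[of ?S "g - c"] True unfolding leg by auto
  next
    case False
    then have "{k. k \<le> i \<and> legal_space v k \<and> c + card {x \<in> {k..i}. legal_space v x} = g} = {}" by auto
    then show ?thesis using False by (simp only: card.empty) simp
  qed
qed

lemma sum_body_middle_E_poly:
  "(\<Sum>q | q \<in> body g (n + 1) \<and> (\<exists>l r. q = l @ (n + 1) # r \<and> l \<noteq> [] \<and> r \<noteq> []).
      preimage_poly (q @ [n + 1 + 1..<n + 1 + l + 1])) =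
    (\<Sum>j = 1..l. \<Sum>a = 2..n. \<Sum>b = max 2 (g - a)..g - 1. \<Sum>i = a - 1..n + 1 - b.
      E_poly a (j - 1) i * E_poly b (l - j + 1) (n - i))"
proof -
  let ?S = "stack_sortable 2"
  define f where "f i j v = preimage_poly (v @ [i + 1..<i + (j - 1) + 1])" for i j v
  define h where "h m j u = preimage_poly (u @ [m + 1..<m + (l - j + 1) + 1])" for m j u
  have "(\<Sum>q | q \<in> body g (n + 1) \<and> (\<exists>l r. q = l @ (n + 1) # r \<and> l \<noteq> [] \<and> r \<noteq> []).
      preimage_poly (q @ [n + 1 + 1..<n + 1 + l + 1])) =
    (\<Sum>i\<in>{1..<n}. \<Sum>v\<in>?S i. \<Sum>u\<in>?S (n - i).
      \<Sum>k | k \<le> i \<and> legal_space v k \<and> leg u + card {x \<in> {k..i}. legal_space v x} = g.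
        preimage_poly (join (n - i - 1) k u v @ [n + 1 + 1..<n + 1 + l + 1]))"
    by (rule sum_body_middle)
  also have "\<dots> = (\<Sum>i\<in>{1..<n}. \<Sum>v\<in>?S i. \<Sum>u\<in>?S (n - i). \<Sum>j = 1..l.
      if leg u < g \<and> g \<le> leg u + leg v then f i j v * h (n - i) j u else 0)"
  proof (intro sum.cong[OF refl])
    fix i v u assume *: "i \<in> {1..<n}" "v \<in> ?S i" "u \<in> ?S (n - i)"
    then have p: "n - i - 1 + 1 = n - i" "n - i - 1 + i + 2 = n + 1" by auto
    have uv: "u \<in> perms (n - i - 1 + 1)" "v \<in> perms i" using * unfolding p stack_sortable_2 by auto
    let ?K = "{k. k \<le> i \<and> legal_space v k \<and> leg u + card {x \<in> {k..i}. legal_space v x} = g}"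
    have "(\<Sum>k\<in>?K. preimage_poly (join (n - i - 1) k u v @ [n + 1 + 1..<n + 1 + l + 1])) =
        (\<Sum>k\<in>?K. \<Sum>j = 1..l. f i j v * h (n - i) j u)"
    proof (rule sum.cong[OF refl])
      fix k assume "k \<in> ?K"
      then have "k \<le> i" "0 < i" using *(1) by auto
      from preimage_poly_join[OF uv this, of l]
      show "preimage_poly (join (n - i - 1) k u v @ [n + 1 + 1..<n + 1 + l + 1]) =
          (\<Sum>j = 1..l. f i j v * h (n - i) j u)"
        unfolding p f_def h_def .
    qed
    \<comment> \<open>The summand is constant in \<open>k\<close>, so only the number of admissible
      spaces matters, which is 0 or 1.\<close>
    also have "\<dots> = of_nat (card ?K) * (\<Sum>j = 1..l. f i j v * h (n - i) j u)" by simp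
    also have "\<dots> = (\<Sum>j = 1..l. if leg u < g \<and> g \<le> leg u + leg v then f i j v * h (n - i) j u else 0)"
      unfolding card_legal_spaces[OF uv(2)]
      by (cases "leg u < g \<and> g \<le> leg u + leg v")
        (simp_all only: if_True if_False of_nat_1 of_nat_0 simp_thms mult_1 mult_zero_left sum.neutral_const)
    finally show "(\<Sum>k\<in>?K. preimage_poly (join (n - i - 1) k u v @ [n + 1 + 1..<n + 1 + l + 1])) =
      (\<Sum>j = 1..l. if leg u < g \<and> g \<le> leg u + leg v then f i j v * h (n - i) j u else 0)" .
  qed
  also have "\<dots> = (\<Sum>j = 1..l. \<Sum>i\<in>{1..<n}. \<Sum>v\<in>?S i. \<Sum>u\<in>?S (n - i).
      if leg u < g \<and> g \<le> leg u + leg v then f i j v * h (n - i) j u else 0)"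
    by (simp only: sum.swap[of _ "{1..l}"])
  also have "\<dots> = (\<Sum>j = 1..l. \<Sum>a = 2..n. \<Sum>b = max 2 (g - a)..g - 1. \<Sum>i = a - 1..n + 1 - b.
      E_poly a (j - 1) i * E_poly b (l - j + 1) (n - i))"
  proof (rule sum.cong[OF refl])
    fix j
    let ?E = "\<lambda>a b i. E_poly a (j - 1) i * E_poly b (l - j + 1) (n - i)"
    have "(\<Sum>i\<in>{1..<n}. \<Sum>v\<in>?S i. \<Sum>u\<in>?S (n - i).
        if leg u < g \<and> g \<le> leg u + leg v then f i j v * h (n - i) j u else 0) =
      (\<Sum>i\<in>{1..<n}. \<Sum>a = 2..n. \<Sum>b = max 2 (g - a)..g - 1. ?E a b i)"
    proof (rule sum.cong[OF refl])
      fix i assume "i \<in> {1..<n}"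
      then have "1 \<le> i" "i < n" by auto
      from sum_stack_sortable_leg[OF this, of g "f i j" "h (n - i) j"]
      show "(\<Sum>v\<in>?S i. \<Sum>u\<in>?S (n - i).
          if leg u < g \<and> g \<le> leg u + leg v then f i j v * h (n - i) j u else 0) =
        (\<Sum>a = 2..n. \<Sum>b = max 2 (g - a)..g - 1. ?E a b i)"
        unfolding E_poly_eq f_def h_def .
    qed
    also have "\<dots> = (\<Sum>a = 2..n. \<Sum>i\<in>{1..<n}. \<Sum>b = max 2 (g - a)..g - 1. ?E a b i)"
      by (rule sum.swap)
    also have "\<dots> = (\<Sum>a = 2..n. \<Sum>b = max 2 (g - a)..g - 1. \<Sum>i\<in>{1..<n}. ?E a b i)"
      by (intro sum.cong refl sum.swap)
    also have "\<dots> = (\<Sum>a = 2..n. \<Sum>b = max 2 (g - a)..g - 1. \<Sum>i = a - 1..n + 1 - b. ?E a b i)"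
    proof (intro sum.cong[OF refl])
      fix a b assume ab: "a \<in> {2..n}" "b \<in> {max 2 (g - a)..g - 1}"
      show "(\<Sum>i\<in>{1..<n}. ?E a b i) = (\<Sum>i = a - 1..n + 1 - b. ?E a b i)"
      \<comment> \<open>For the other \<open>i\<close> one of the two patterns is too short to have
        that many legal spaces.\<close>
      proof (rule sum.mono_neutral_right)
        show "{a - 1..n + 1 - b} \<subseteq> {1..<n}" using ab by auto
        show "\<forall>i\<in>{1..<n} - {a - 1..n + 1 - b}. ?E a b i = 0"
        proof
          fix i assume i: "i \<in> {1..<n} - {a - 1..n + 1 - b}"
          then have "i + 1 < a \<or> n - i + 1 < b" using ab by auto
          then have "body a i = {} \<or> body b (n - i) = {}" using i body_empty[of i a] body_empty[of "n - i" b] by auto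
          then show "?E a b i = 0" unfolding E_poly_eq by (elim disjE) simp_all
        qed
      qed simp
    qed
    finally show "(\<Sum>i\<in>{1..<n}. \<Sum>v\<in>?S i. \<Sum>u\<in>?S (n - i).
        if leg u < g \<and> g \<le> leg u + leg v then f i j v * h (n - i) j u else 0) =
      (\<Sum>a = 2..n. \<Sum>b = max 2 (g - a)..g - 1. \<Sum>i = a - 1..n + 1 - b. ?E a b i)" .
  qed
  finally show ?thesis .
qed

section \<open>Assembly of the recursion\<close>

lemma E_poly_0: "1 \<le> n \<Longrightarrow> E_poly 0 l n = 0"
  using body_empty[of n 0] unfolding E_poly_eq by simp

lemma E_poly_1: "E_poly g l 1 = (if g = 2 then L_poly (l + 1) else 0)"
proof -
  have "[1] @ [1 + 1..<1 + l + 1] = [1..<1 + l + 1]"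
    by (simp add: upt_conv_Cons del: upt_Suc)
  moreover have "preimage_poly [1..<1 + l + 1] = L_poly (l + 1)"
    using preimage_poly_increasing[of "[1..<1 + l + 1]"] by (simp del: upt_Suc)
  ultimately show ?thesis unfolding E_poly_eq body_1 by (simp del: upt_Suc)
qed

text \<open>The letter \<open>n + 1\<close> of the body is last, first or interior, which yields the
  final term, the terms with \<open>L_poly\<close> and the multiple sum.\<close>

lemma E_poly_Suc:
  assumes "1 \<le> n" "1 \<le> g"
  shows "E_poly g l (n + 1) =
        (\<Sum>j = 1..l.
          (\<Sum>a = 2..n. \<Sum>b = max 2 (g - a)..g - 1. \<Sum>i = a - 1..n + 1 - b.
            E_poly a (j - 1) i * E_poly b (l - j + 1) (n - i))
          + E_poly (g - 1) (j - 1) n * L_poly (l - j + 1))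
        + E_poly (g - 1) (l + 1) n"
proof -
  define A where "A = {q \<in> body g (n + 1). \<exists>l. q = l @ [n + 1]}"
  define B where "B = {q \<in> body g (n + 1). \<exists>r. q = (n + 1) # r}"
  define C where "C = {q \<in> body g (n + 1). \<exists>l r. q = l @ (n + 1) # r \<and> l \<noteq> [] \<and> r \<noteq> []}"
  have perm: "distinct q \<and> set q = {1..n + 1}" if "q \<in> body g (n + 1)" for q
    using that unfolding body_def stack_sortable_2 perms_iff by blast
  have "q \<in> A \<union> B \<union> C" if q: "q \<in> body g (n + 1)" for q
  proof -
    have "n + 1 \<in> set q" using perm[OF q] by simp
    then obtain l r where "q = l @ (n + 1) # r" by (meson split_list)
    then show ?thesis using q unfolding A_def B_def C_def by (cases "l = []"; cases "r = []") auto
  qed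
  then have body: "body g (n + 1) = A \<union> B \<union> C" by (auto simp: A_def B_def C_def)
  \<comment> \<open>Only a word of length 1 has its maximum both first and last.\<close>
  have AB: "A \<inter> B = {}"
  proof -
    have False if qA: "q \<in> A" and qB: "q \<in> B" for q
    proof -
      obtain l r where lr: "q = l @ [n + 1]" "q = (n + 1) # r" using qA qB unfolding A_def B_def by blast
      have q: "distinct q" "set q = {1..n + 1}" using perm qA by (auto simp: A_def)
      have "l = []" using lr q(1) by (cases l) auto
      then have "card (set q) = 1" using lr by simp
      then show False using q(2) assms(1) by simp
    qed
    then show ?thesis by blast
  qed
  have ABC: "(A \<union> B) \<inter> C = {}"
  proof -
    have False if qAB: "q \<in> A \<union> B" and qC: "q \<in> C" for q
    proof -
      obtain l r where lr: "q = l @ (n + 1) # r" "l \<noteq> []" "r \<noteq> []" using qC by (auto simp: C_def)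
      have "distinct q" using perm qC by (auto simp: C_def)
      then have "n + 1 \<notin> set l" "n + 1 \<notin> set r" using lr by auto
      moreover have "hd q \<in> set l" "last q \<in> set r" using lr by auto
      moreover have "hd q = n + 1 \<or> last q = n + 1" using qAB by (auto simp: A_def B_def)
      ultimately show False by metis
    qed
    then show ?thesis by blast
  qed
  have "finite A" "finite B" "finite C" by (auto simp: A_def B_def C_def)
  then have "E_poly g l (n + 1) =
      (\<Sum>q\<in>A. preimage_poly (q @ [n + 1 + 1..<n + 1 + l + 1])) +
      (\<Sum>q\<in>B. preimage_poly (q @ [n + 1 + 1..<n + 1 + l + 1])) +
      (\<Sum>q\<in>C. preimage_poly (q @ [n + 1 + 1..<n + 1 + l + 1]))"
    unfolding E_poly_eq body using AB ABC by (simp add: sum.union_disjoint del: upt_Suc)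
  also have "\<dots> = E_poly (g - 1) (l + 1) n +
      (\<Sum>j = 1..l. E_poly (g - 1) (j - 1) n * L_poly (l - j + 1)) +
      (\<Sum>j = 1..l. \<Sum>a = 2..n. \<Sum>b = max 2 (g - a)..g - 1. \<Sum>i = a - 1..n + 1 - b.
        E_poly a (j - 1) i * E_poly b (l - j + 1) (n - i))"
    using assms unfolding A_def B_def C_def
    by (simp only: sum_body_last sum_body_first sum_body_middle_E_poly)
  finally show ?thesis by (simp only: sum.distrib ac_simps)
qed

lemma stack_sortable_Suc: "stack_sortable (Suc t) n = stack_sort -` stack_sortable t n"
proof -
  have "p \<in> perms n \<longleftrightarrow> stack_sort p \<in> perms n" for p unfolding perms_iff by simp
  then show ?thesis by (auto simp: stack_sortable_def funpow_Suc_right simp del: funpow.simps)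
qed

text \<open>One more sorting step leads to the 2-stack-sortable words, which are grouped by their
  number of legal spaces.\<close>

lemma des_peak_poly_stack_sortable_3:
  assumes "1 \<le> n"
  shows "des_peak_poly (stack_sortable 3 n) = (\<Sum>g = 1..n + 1. E_poly g 0 n)"
proof -
  have "stack_sortable 3 n = stack_sort -` stack_sortable 2 n"
    using stack_sortable_Suc[of 2] by (simp add: eval_nat_numeral)
  then have "des_peak_poly (stack_sortable 3 n) = (\<Sum>w\<in>stack_sortable 2 n. preimage_poly w)"
    by (simp add: des_peak_poly_vimage_stack_sort)
  also have "\<dots> = (\<Sum>g = 1..n + 1. \<Sum>w\<in>{w \<in> stack_sortable 2 n. leg w = g}. preimage_poly w)"
  proof (rule sum.group[symmetric])
    show "leg ` stack_sortable 2 n \<subseteq> {1..n + 1}"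
      using leg_bounds[of _ n] assms by (force simp: stack_sortable_2)
  qed auto
  also have "\<dots> = (\<Sum>g = 1..n + 1. E_poly g 0 n)"
    unfolding E_poly_eq body_def by simp
  finally show ?thesis .
qed

theorem theorem9:
  shows "(\<forall>n\<ge>1. des_peak_poly (stack_sortable 3 n) = (\<Sum>g = 1..n + 1. E_poly g 0 n)) \<and>
    (\<forall>n\<ge>1. \<forall>l. E_poly 0 l n = 0) \<and>
    (\<forall>g l. E_poly g l 1 = (if g = 2 then L_poly (l + 1) else 0)) \<and>
    (\<forall>n\<ge>1. \<forall>g\<ge>1. \<forall>l.
      E_poly g l (n + 1) =
        (\<Sum>j = 1..l.
          (\<Sum>a = 2..n. \<Sum>b = max 2 (g - a)..g - 1. \<Sum>i = a - 1..n + 1 - b.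
            E_poly a (j - 1) i * E_poly b (l - j + 1) (n - i))
          + E_poly (g - 1) (j - 1) n * L_poly (l - j + 1))
        + E_poly (g - 1) (l + 1) n)"
  using des_peak_poly_stack_sortable_3 E_poly_0 E_poly_1 E_poly_Suc by blast

end
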